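(* Let $M$ be a matroid on a finite linearly ordered set $E$ and let $B$ be a basis of $M$. The active filtration of $B$ is the unique filtration $\emptyset=F'_\varepsilon\subset\dots\subset F'_0=F_c=F_0\subset\dots\subset F_\iota=E$ of $E$ (and also the unique connected filtration of $M$) such that: - for all $1\le k\le\iota$, the set $B_k=B\cap(F_k\setminus F_{k-1})$ is a uniactive internal basis of the minor $M_k=M(F_k)/F_{k-1}$; - for all $1\le k\le\varepsilon$, the set $B'_k=B\cap(F'_{k-1}\setminus F'_k)$ is a uniactive external basis of the minor $M'_k=M(F'_{k-1})/F'_k$. In particular, the active filtration of $B$ is a connected filtration of $M$. Moreover, for this filtration, for $1\le k\le\iota$, if $M(F_k)/F_{k-1}$ is an isthmus then $B_k$ equals this isthmus, and, for $1\le k\le\varepsilon$, if $M(F'_{k-1})/F'_k$ is a loop then $B'_k=\emptyset$.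
   Context: $\subset$ denotes strict inclusion. For $A\subseteq G\subseteq E$, $M(G)/A$ is the minor obtained by restricting $M$ to $G$ and contracting $A$, with the induced order on its ground set. A matroid is called an isthmus, resp. a loop, if it has exactly one element and that element is a coloop, resp. a loop. One-element matroids are connected. For a basis $B$ of $M$: for $b\in B$, $C^*(B;b)$ is the fundamental cocircuit (the unique cocircuit contained in $(E\setminus B)\cup\{b\}$), and for $e\in E\setminus B$, $C(B;e)$ is the fundamental circuit (the unique circuit contained in $B\cup\{e\}$). $\mathrm{Int}(B)=\{b\in B: b=\min C^*(B;b)\}$ and $\mathrm{Ext}(B)=\{e\in E\setminus B: e=\min C(B;e)\}$. A basis is uniactive internal if $|\mathrm{Int}|=1$ and $\mathrm{Ext}=\emptyset$, and uniactive external if $\mathrm{Int}=\emptyset$ and $|\mathrm{Ext}|=1$ (the unique active element is then the minimum of the ground set). Filtrations. A filtration of $E$ (or of $M$) is a sequence $(F'_\varepsilon,\dots,F'_0,F_c,F_0,\dots,F_\iota)$ of subsets of $E$ ($\iota,\varepsilon\ge 0$) such that $\emptyset=F'_\varepsilon\subset\dots\subset F'_0=F_c=F_0\subset\dots\subset F_\iota=E$, the sequence $\min(F_k\setminus F_{k-1})$, $1\le k\le\iota$, is increasing with $k$, and the sequence $\min(F'_{k-1}\setminus F'_k)$, $1\le k\le\varepsilon$, is increasing with $k$. It is a connected filtration of $M$ if in addition $M(F_k)/F_{k-1}$ is connected and not a loop for $1\le k\le\iota$, and $M(F'_{k-1})/F'_k$ is connected and not an isthmus for $1\le k\le\varepsilon$.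 Active closure. For $b\in B$ let $C^*(B;b)^<=\{e\in C^*(B;b): e<b\}$, and for $e\in E\setminus B$ let $C(B;e)^<=\{b\in C(B;e): b<e\}$. For $X\subseteq\mathrm{Int}(B)$, $\mathrm{acl}(X)$ is the smallest subset of $E$ (for inclusion) such that $X\subseteq\mathrm{acl}(X)$; if $b\in B\cap\mathrm{acl}(X)$ then $C^*(B;b)\subseteq\mathrm{acl}(X)$; and if $b\in B$ and $\emptyset\ne C^*(B;b)^<\subseteq\mathrm{acl}(X)$ then $b\in\mathrm{acl}(X)$. For $X\subseteq\mathrm{Ext}(B)$, $\mathrm{acl}(X)$ is the smallest subset of $E$ such that $X\subseteq\mathrm{acl}(X)$; if $e\in (E\setminus B)\cap\mathrm{acl}(X)$ then $C(B;e)\subseteq\mathrm{acl}(X)$; and if $e\in E\setminus B$ and $\emptyset\ne C(B;e)^<\subseteq\mathrm{acl}(X)$ then $e\in\mathrm{acl}(X)$. Active filtration. Let $a_1<\dots<a_\iota$ be the elements of $\mathrm{Int}(B)$ and $a'_1<\dots<a'_\varepsilon$ those of $\mathrm{Ext}(B)$. The active filtration of $B$ is the sequence $(F'_\varepsilon,\dots,F'_0,F_c,F_0,\dots,F_\iota)$ with $F_c=\mathrm{acl}(\mathrm{Ext}(B))=E\setminus\mathrm{acl}(\mathrm{Int}(B))$ (these two sets are equal); $F_\iota=E$ and $F_k=E\setminus\mathrm{acl}(\{a_{k+1},\dots,a_\iota\})$ for $0\le k\le\iota-1$; $F'_\varepsilon=\emptyset$ and $F'_k=\mathrm{acl}(\{a'_{k+1},\dots,a'_\varepsilon\})$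 for $0\le k\le\varepsilon-1$ (and $F_0=F'_0=F_c$). *)

theory Defs
  imports Main
begin

section \<open>Finite matroids\<close>

record 'a set_system =
  ground :: "'a set"
  indep :: "'a set \<Rightarrow> bool"

definition matroid :: "'a set_system \<Rightarrow> bool" where
  "matroid M \<longleftrightarrow>
     finite (ground M) \<and>
     (\<forall>X. indep M X \<longrightarrow> X \<subseteq> ground M) \<and>
     indep M {} \<and>
     (\<forall>X Y. indep M Y \<longrightarrow> X \<subseteq> Y \<longrightarrow> indep M X) \<and>
     (\<forall>X Y. indep M X \<longrightarrow> indep M Y \<longrightarrow> card X < card Y \<longrightarrow>
        (\<exists>e\<in>Y - X. indep M (insert e X)))"

definition basis :: "'a set_system \<Rightarrow> 'a set \<Rightarrow> bool" where
  "basis M B \<longleftrightarrow> indep M B \<and> (\<forall>X. indep M X \<longrightarrow> B \<subseteq> X \<longrightarrow> X = B)"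

definition circuit :: "'a set_system \<Rightarrow> 'a set \<Rightarrow> bool" where
  "circuit M C \<longleftrightarrow> C \<subseteq> ground M \<and> \<not> indep M C \<and> (\<forall>X. X \<subset> C \<longrightarrow> indep M X)"

definition dual :: "'a set_system \<Rightarrow> 'a set_system" where
  "dual M = \<lparr>ground = ground M,
             indep = (\<lambda>X. X \<subseteq> ground M \<and> (\<exists>B. basis M B \<and> X \<inter> B = {}))\<rparr>"

definition cocircuit :: "'a set_system \<Rightarrow> 'a set \<Rightarrow> bool" where
  "cocircuit M D \<longleftrightarrow> circuit (dual M) D"

definition restriction :: "'a set_system \<Rightarrow> 'a set \<Rightarrow> 'a set_system" where
  "restriction M G = \<lparr>ground = G, indep = (\<lambda>X. X \<subseteq> G \<and> indep M X)\<rparr>"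

definition contraction :: "'a set_system \<Rightarrow> 'a set \<Rightarrow> 'a set_system" where
  "contraction M A = \<lparr>ground = ground M - A,
     indep = (\<lambda>X. X \<subseteq> ground M - A \<and>
                  (\<exists>J. basis (restriction M A) J \<and> indep M (X \<union> J)))\<rparr>"

text \<open>\<open>minor M G A\<close> is $M(G)/A$; it is only used for \<open>A \<subseteq> G \<subseteq> ground M\<close>.\<close>

definition minor :: "'a set_system \<Rightarrow> 'a set \<Rightarrow> 'a set \<Rightarrow> 'a set_system" where
  "minor M G A = contraction (restriction M G) A"

definition connected_matroid :: "'a set_system \<Rightarrow> bool" where
  "connected_matroid M \<longleftrightarrow>
     (\<forall>e\<in>ground M. \<forall>f\<in>ground M. e \<noteq> f \<longrightarrow> (\<exists>C. circuit M C \<and> e \<in> C \<and> f \<in> C))"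

definition loop :: "'a set_system \<Rightarrow> 'a \<Rightarrow> bool" where
  "loop M e \<longleftrightarrow> circuit M {e}"

definition coloop :: "'a set_system \<Rightarrow> 'a \<Rightarrow> bool" where
  "coloop M e \<longleftrightarrow> cocircuit M {e}"

definition is_loop :: "'a set_system \<Rightarrow> bool" where
  "is_loop M \<longleftrightarrow> (\<exists>e. ground M = {e} \<and> loop M e)"

definition is_isthmus :: "'a set_system \<Rightarrow> bool" where
  "is_isthmus M \<longleftrightarrow> (\<exists>e. ground M = {e} \<and> coloop M e)"

section \<open>Activities\<close>

text \<open>The descriptions below are meaningful for a basis \<open>B\<close> and
  \<open>e \<in> ground M - B\<close>, respectively \<open>b \<in> B\<close>, which is how they are used.\<close>

definition fund_circuit :: "'a set_system \<Rightarrow> 'a set \<Rightarrow> 'a \<Rightarrow> 'a set" where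
  "fund_circuit M B e = (THE C. circuit M C \<and> C \<subseteq> insert e B)"

definition fund_cocircuit :: "'a set_system \<Rightarrow> 'a set \<Rightarrow> 'a \<Rightarrow> 'a set" where
  "fund_cocircuit M B b = (THE D. cocircuit M D \<and> D \<subseteq> insert b (ground M - B))"

definition int_active :: "'a::linorder set_system \<Rightarrow> 'a set \<Rightarrow> 'a set" where
  "int_active M B = {b \<in> B. b = Min (fund_cocircuit M B b)}"

definition ext_active :: "'a::linorder set_system \<Rightarrow> 'a set \<Rightarrow> 'a set" where
  "ext_active M B = {e \<in> ground M - B. e = Min (fund_circuit M B e)}"

definition uniactive_internal :: "'a::linorder set_system \<Rightarrow> 'a set \<Rightarrow> bool" where
  "uniactive_internal M B \<longleftrightarrow>
     basis M B \<and> card (int_active M B) = 1 \<and> ext_active M B = {}"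

definition uniactive_external :: "'a::linorder set_system \<Rightarrow> 'a set \<Rightarrow> bool" where
  "uniactive_external M B \<longleftrightarrow>
     basis M B \<and> int_active M B = {} \<and> card (ext_active M B) = 1"

section \<open>Filtrations\<close>

text \<open>
  A filtration $(F'_\varepsilon,\dots,F'_0,F_c,F_0,\dots,F_\iota)$ is encoded as the triple
  \<open>(F', Fc, F)\<close> with the lists \<open>F' = [F'_0, ..., F'_\<epsilon>]\<close> (in order of increasing index,
  hence decreasing for inclusion) and \<open>F = [F_0, ..., F_\<iota>]\<close>. So \<open>\<epsilon> = length F' - 1\<close> and
  \<open>\<iota> = length F - 1\<close>, and two filtrations are the same sequence iff their triples are equal.
\<close>

type_synonym 'a filtr = "'a set list \<times> 'a set \<times> 'a set list"

fun filtration :: "'a::linorder set \<Rightarrow> 'a filtr \<Rightarrow> bool" where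
  "filtration E (F', Fc, F) \<longleftrightarrow>
     F' \<noteq> [] \<and> F \<noteq> [] \<and>
     last F' = {} \<and> F' ! 0 = Fc \<and> Fc = F ! 0 \<and> last F = E \<and>
     (\<forall>k\<in>{1..length F' - 1}. F' ! k \<subset> F' ! (k - 1)) \<and>
     (\<forall>k\<in>{1..length F - 1}. F ! (k - 1) \<subset> F ! k) \<and>
     strict_mono_on {1..length F - 1} (\<lambda>k. Min (F ! k - F ! (k - 1))) \<and>
     strict_mono_on {1..length F' - 1} (\<lambda>k. Min (F' ! (k - 1) - F' ! k))"

fun connected_filtration :: "'a::linorder set_system \<Rightarrow> 'a filtr \<Rightarrow> bool" where
  "connected_filtration M (F', Fc, F) \<longleftrightarrow>
     filtration (ground M) (F', Fc, F) \<and>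
     (\<forall>k\<in>{1..length F - 1}.
        connected_matroid (minor M (F ! k) (F ! (k - 1))) \<and>
        \<not> is_loop (minor M (F ! k) (F ! (k - 1)))) \<and>
     (\<forall>k\<in>{1..length F' - 1}.
        connected_matroid (minor M (F' ! (k - 1)) (F' ! k)) \<and>
        \<not> is_isthmus (minor M (F' ! (k - 1)) (F' ! k)))"

fun uniactive_decomposition :: "'a::linorder set_system \<Rightarrow> 'a set \<Rightarrow> 'a filtr \<Rightarrow> bool" where
  "uniactive_decomposition M B (F', Fc, F) \<longleftrightarrow>
     (\<forall>k\<in>{1..length F - 1}.
        uniactive_internal (minor M (F ! k) (F ! (k - 1))) (B \<inter> (F ! k - F ! (k - 1)))) \<and>
     (\<forall>k\<in>{1..length F' - 1}.
        uniactive_external (minor M (F' ! (k - 1)) (F' ! k)) (B \<inter> (F' ! (k - 1) - F' ! k)))"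

section \<open>Active closure and active filtration\<close>

text \<open>\<open>acl_int\<close> is used for \<open>X \<subseteq> int_active M B\<close>, \<open>acl_ext\<close> for \<open>X \<subseteq> ext_active M B\<close>.
  The closure conditions are stable under intersection, so the least set exists.\<close>

definition acl_int :: "'a::linorder set_system \<Rightarrow> 'a set \<Rightarrow> 'a set \<Rightarrow> 'a set" where
  "acl_int M B X = (LEAST A. A \<subseteq> ground M \<and> X \<subseteq> A \<and>
     (\<forall>b\<in>B \<inter> A. fund_cocircuit M B b \<subseteq> A) \<and>
     (\<forall>b\<in>B. {e \<in> fund_cocircuit M B b. e < b} \<noteq> {} \<longrightarrow>
             {e \<in> fund_cocircuit M B b. e < b} \<subseteq> A \<longrightarrow> b \<in> A))"

definition acl_ext :: "'a::linorder set_system \<Rightarrow> 'a set \<Rightarrow> 'a set \<Rightarrow> 'a set" where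
  "acl_ext M B X = (LEAST A. A \<subseteq> ground M \<and> X \<subseteq> A \<and>
     (\<forall>e\<in>(ground M - B) \<inter> A. fund_circuit M B e \<subseteq> A) \<and>
     (\<forall>e\<in>ground M - B. {b \<in> fund_circuit M B e. b < e} \<noteq> {} \<longrightarrow>
             {b \<in> fund_circuit M B e. b < e} \<subseteq> A \<longrightarrow> e \<in> A))"

text \<open>
  For the sorted list \<open>a\<close> of internally active elements, \<open>set (drop k a)\<close> is
  $\{a_{k+1},\dots,a_\iota\}$. The list entry \<open>F_0\<close> is \<open>ground M - acl_int M B (int_active M B)\<close>
  while the middle component is \<open>acl_ext M B (ext_active M B)\<close>; that they agree is part of the
  triple being a filtration.
\<close>

definition active_filtration :: "'a::linorder set_system \<Rightarrow> 'a set \<Rightarrow> 'a filtr" where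
  "active_filtration M B =
     (let a = sorted_list_of_set (int_active M B);
          a' = sorted_list_of_set (ext_active M B)
      in (map (\<lambda>k. acl_ext M B (set (drop k a'))) [0..<length a'] @ [{}],
          acl_ext M B (ext_active M B),
          map (\<lambda>k. ground M - acl_int M B (set (drop k a))) [0..<length a] @ [ground M]))"

end

theory Submission
  imports Defs
begin

text \<open>
  Activities and active closures only depend on the fundamental graph of the basis, the bipartite graph
  on \<open>B\<close> and \<open>E - B\<close> joining \<open>b\<close> and \<open>e\<close> when \<open>b \<in> C(B;e)\<close>, equivalently \<open>e \<in> C\<^sup>*(B;b)\<close>. If
  $B \cap A$ and $B \cap G$ span \<open>A\<close> and \<open>G\<close>, the fundamental graph of $B \cap (G \setminus A)$ in
  $M(G)/A$ is the induced subgraph. Induction along a filtration shows that every set in a uniactive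
  decomposition is spanned by its intersection with \<open>B\<close>, so the decomposition is a statement about
  induced subgraphs in which every vertex but the minimum has a smaller neighbour; both existence and
  uniqueness then follow by looking at minimal vertices. The same property makes a uniactive minor
  connected: neighbours lie in a common circuit, and lying in a common circuit is transitive.
\<close>

section \<open>Ordered bipartite graphs\<close>

text \<open>A candidate filtration comes with no relation between its sets and the graph of
  \<open>B\<close>: uniactivity speaks of each minor separately, and a minor is seen in the graph
  only after the two sets bounding it are known to be spanned. Spanning is therefore propagated
  upwards from the empty set through \<open>F_c\<close> to the ground set, the basis condition of
  each minor giving the next step. A set is spanned iff no fundamental circuit of one of its
  elements outside \<open>B\<close> leaves it, equivalently iff no fundamental cocircuit of an
  element of \<open>B\<close> in its complement leaves that complement. Complementing the internal
  half thus makes both halves decreasing chains of closed sets ending in the empty set, and one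
  argument serves both. Uniqueness of one half needs information from beyond its first set: the
  vertices of \<open>P\<close> there must have a smaller neighbour also there. The other half
  supplies it, since its pieces have no local minimum on that side. Connectedness follows from
  uniactivity, so the second uniqueness claim reduces to the first.\<close>

text \<open>
  With \<open>P = B\<close> and \<open>Q = E - B\<close> the locale describes the internal side, and with \<open>P\<close> and \<open>Q\<close>
  interchanged the external side. A chain lists the sets $E \setminus F_0, \dots, E \setminus F_\iota$
  on the internal side and $F'_0, \dots, F'_\varepsilon$ on the external side.
\<close>

locale fundamental_graph =
  fixes P Q :: "'a::linorder set" and adj :: "'a \<Rightarrow> 'a \<Rightarrow> bool"
  assumes finite_P: "finite P" and finite_Q: "finite Q" and disjoint: "P \<inter> Q = {}"
    and adj_sym: "adj v w \<Longrightarrow> adj w v"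
    and adj_bipartite: "adj v w \<Longrightarrow> v \<in> P \<and> w \<in> Q \<or> v \<in> Q \<and> w \<in> P"
begin

definition active :: "'a set" where
  "active = {v \<in> P. \<forall>w. adj v w \<longrightarrow> v < w}"

text \<open>The active vertices on side \<open>U\<close> of the induced subgraph on
  \<open>H\<close>. The side is a parameter because a uniactive piece constrains both sides: one
  such vertex on the first, none on the second.\<close>

definition local_min :: "'a set \<Rightarrow> 'a set \<Rightarrow> 'a set" where
  "local_min U H = {v \<in> U \<inter> H. \<forall>w\<in>H. adj v w \<longrightarrow> v < w}"

text \<open>When \<open>P\<close> is the complement of \<open>B\<close>, these are the sets spanned
  by their intersection with \<open>B\<close>; when \<open>P\<close> is \<open>B\<close>, they are
  the complements of such sets.\<close>

definition P_closed :: "'a set \<Rightarrow> bool" where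
  "P_closed A \<longleftrightarrow> A \<subseteq> P \<union> Q \<and> (\<forall>v\<in>P \<inter> A. \<forall>w. adj v w \<longrightarrow> w \<in> A)"

definition acl_closed :: "'a set \<Rightarrow> 'a set \<Rightarrow> bool" where
  "acl_closed X A \<longleftrightarrow> P_closed A \<and> X \<subseteq> A \<and>
     (\<forall>v\<in>P. (\<exists>w. adj v w \<and> w < v) \<longrightarrow> (\<forall>w. adj v w \<longrightarrow> w < v \<longrightarrow> w \<in> A) \<longrightarrow> v \<in> A)"

definition acl :: "'a set \<Rightarrow> 'a set" where
  "acl X = \<Inter> {A. acl_closed X A}"

text \<open>One half of a filtration. The first set is left free: it stands for \<open>F_c\<close>
  or its complement, depending on the side.\<close>

definition uniactive_chain :: "'a set list \<Rightarrow> bool" where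
  "uniactive_chain D \<longleftrightarrow> D \<noteq> [] \<and> last D = {} \<and> (\<forall>A\<in>set D. P_closed A) \<and>
     (\<forall>k. Suc k < length D \<longrightarrow> D ! Suc k \<subset> D ! k \<and>
        card (local_min P (D ! k - D ! Suc k)) = 1 \<and> local_min Q (D ! k - D ! Suc k) = {}) \<and>
     (\<forall>i j. i < j \<longrightarrow> Suc j < length D \<longrightarrow>
        Min (D ! i - D ! Suc i) < Min (D ! j - D ! Suc j))"

lemma adj_neq: "adj v w \<Longrightarrow> v \<noteq> w"
  using adj_bipartite disjoint by blast

lemma active_subset: "active \<subseteq> P"
  by (auto simp: active_def)

lemma finite_active: "finite active"
  using active_subset finite_P finite_subset by blast

lemma not_active_smaller:
  assumes "v \<in> P" "v \<notin> active"
  shows "\<exists>w. adj v w \<and> w < v"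
proof -
  obtain w where "adj v w" "\<not> v < w" using assms by (auto simp: active_def)
  then show ?thesis using adj_neq[of v w] by (intro exI[of _ w]) auto
qed

lemma not_local_min_smaller:
  assumes "v \<in> U" "v \<in> H" "v \<notin> local_min U H"
  shows "\<exists>w\<in>H. adj v w \<and> w < v"
proof -
  obtain w where "w \<in> H" "adj v w" "\<not> v < w" using assms by (auto simp: local_min_def)
  then show ?thesis using adj_neq[of v w] by (intro bexI[of _ w]) auto
qed

lemma P_closed_subset: "P_closed A \<Longrightarrow> A \<subseteq> P \<union> Q"
  and P_closed_neighbour: "P_closed A \<Longrightarrow> v \<in> P \<Longrightarrow> v \<in> A \<Longrightarrow> adj v w \<Longrightarrow> w \<in> A"
  by (auto simp: P_closed_def)

section \<open>The active closure as a least closed set\<close>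

lemma acl_least: "acl_closed X A \<Longrightarrow> acl X \<subseteq> A"
  by (auto simp: acl_def)

lemma acl_closedI:
  assumes "A \<subseteq> P \<union> Q" "X \<subseteq> A" "\<And>v w. v \<in> P \<Longrightarrow> v \<in> A \<Longrightarrow> adj v w \<Longrightarrow> w \<in> A"
    "\<And>v w. v \<in> P \<Longrightarrow> adj v w \<Longrightarrow> w < v \<Longrightarrow> (\<And>u. adj v u \<Longrightarrow> u < v \<Longrightarrow> u \<in> A) \<Longrightarrow> v \<in> A"
  shows "acl_closed X A"
  unfolding acl_closed_def P_closed_def using assms by blast

lemma acl_closed_subset: "acl_closed X A \<Longrightarrow> A \<subseteq> P \<union> Q"
  and acl_closed_contains: "acl_closed X A \<Longrightarrow> X \<subseteq> A"
  and acl_closed_neighbour: "acl_closed X A \<Longrightarrow> v \<in> P \<Longrightarrow> v \<in> A \<Longrightarrow> adj v w \<Longrightarrow> w \<in> A"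
  by (auto simp: acl_closed_def P_closed_def)

lemma acl_closed_smaller:
  assumes "acl_closed X A" "v \<in> P" "adj v w" "w < v" "\<And>u. adj v u \<Longrightarrow> u < v \<Longrightarrow> u \<in> A"
  shows "v \<in> A"
proof -
  have "\<forall>v\<in>P. (\<exists>w. adj v w \<and> w < v) \<longrightarrow> (\<forall>w. adj v w \<longrightarrow> w < v \<longrightarrow> w \<in> A) \<longrightarrow> v \<in> A"
    using assms(1) unfolding acl_closed_def by (elim conjE)
  then show ?thesis using assms(2-) by blast
qed

lemma acl_closed_acl:
  assumes "X \<subseteq> P \<union> Q"
  shows "acl_closed X (acl X)"
proof -
  have E: "acl_closed X (P \<union> Q)"
    using assms adj_bipartite by (intro acl_closedI) auto
  show ?thesis
  proof (rule acl_closedI)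
    show "acl X \<subseteq> P \<union> Q" using acl_least[OF E] .
    show "X \<subseteq> acl X" by (auto simp: acl_def dest: acl_closed_contains)
    show "w \<in> acl X" if "v \<in> P" "v \<in> acl X" "adj v w" for v w
      using that acl_closed_neighbour[of X _ v w] by (auto simp: acl_def)
    show "v \<in> acl X" if "v \<in> P" "adj v w" "w < v" "\<And>u. adj v u \<Longrightarrow> u < v \<Longrightarrow> u \<in> acl X" for v w
      unfolding acl_def
    proof clarify
      fix A assume A: "acl_closed X A"
      show "v \<in> A"
        using acl_closed_smaller[OF A that(1-3)] that(4) acl_least[OF A] by blast
    qed
  qed
qed

lemma Least_acl_closed: "X \<subseteq> P \<union> Q \<Longrightarrow> (LEAST A. acl_closed X A) = acl X"
  by (rule Least_equality) (auto intro: acl_closed_acl dest: acl_least)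

lemma acl_mono:
  assumes "X \<subseteq> Y" "Y \<subseteq> P \<union> Q"
  shows "acl X \<subseteq> acl Y"
  using acl_closed_acl[of Y] assms by (intro acl_least) (auto simp: acl_closed_def)

text \<open>Minimality of the closure: if \<open>v\<close> had no smaller neighbour in it, then
  \<open>v\<close>, together with its neighbours when \<open>v\<close> lies in \<open>Q\<close>,
  could be deleted and the rest would still be closed and contain \<open>X\<close>.\<close>

lemma acl_smaller_neighbour:
  assumes "X \<subseteq> active" "v \<in> acl X" "v \<notin> X"
  shows "\<exists>w\<in>acl X. adj v w \<and> w < v"
proof (rule ccontr)
  assume none: "\<not> ?thesis"
  have cl: "acl_closed X (acl X)"
    using acl_closed_acl assms(1) active_subset by blast
  then have "v \<in> P \<or> v \<in> Q"
    using assms(2) by (auto simp: acl_closed_def P_closed_def)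
  then show False
  proof
    assume v: "v \<in> P"
    \<comment> \<open>All neighbours of a vertex of \<open>P\<close> in the closure are in the
      closure, so \<open>v\<close> has no smaller neighbour at all and the second closure rule is
      vacuous for it.\<close>
    have "\<not> (\<exists>w. adj v w \<and> w < v)"
      using none acl_closed_neighbour[OF cl v assms(2)] by blast
    moreover have "\<not> adj u v" if "u \<in> P" for u
      using that v adj_bipartite disjoint by blast
    ultimately have "acl_closed X (acl X - {v})"
      using acl_closed_subset[OF cl] acl_closed_contains[OF cl] assms(3)
        acl_closed_neighbour[OF cl] acl_closed_smaller[OF cl]
      by (intro acl_closedI) (blast, blast, blast, metis DiffD1 DiffI singletonD)
    then show False
      using acl_least assms(2) by blast
  next
    assume v: "v \<in> Q"
    have greater: "v < w" if "w \<in> acl X" "adj v w" for w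
      using none that adj_neq by (metis linorder_neqE)
    \<comment> \<open>Neighbours of \<open>v\<close> can only enter the closure after \<open>v\<close>, so all of them can be dropped together with \<open>v\<close>.\<close>
    define S where "S = insert v {w. adj v w}"
    have "x \<notin> S" if "x \<in> X" for x
    proof
      assume "x \<in> S"
      then have "adj v x" using that assms(3) by (auto simp: S_def)
      then show False
        using greater[of x] that cl assms(1) adj_sym[of v x]
        by (auto simp: acl_closed_def active_def dest: less_asym)
    qed
    moreover have "w \<notin> S" if u: "u \<in> P" "u \<notin> S" "adj u w" for u w
      using that adj_sym[of u w] adj_bipartite[of v] adj_bipartite[of u w] disjoint v
      by (auto simp: S_def)
    moreover have "u \<notin> S" if "u \<in> P" "u \<in> acl X" "\<forall>w. adj u w \<longrightarrow> w < u \<longrightarrow> w \<in> acl X - S" for u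
      using that v disjoint greater[of u] adj_sym[of v u] by (auto simp: S_def)
    ultimately have "acl_closed X (acl X - S)"
      using acl_closed_subset[OF cl] acl_closed_contains[OF cl]
        acl_closed_neighbour[OF cl] acl_closed_smaller[OF cl]
      by (intro acl_closedI) (blast, blast, blast, metis DiffD1 DiffI)
    then show False
      using acl_least assms(2) by (auto simp: S_def)
  qed
qed

text \<open>An active vertex has no smaller neighbour, so it can enter a closure only as a member of
  \<open>X\<close>. Hence enlarging \<open>X\<close> by an active vertex enlarges the closure
  strictly.\<close>

lemma acl_Int_active:
  assumes "X \<subseteq> active"
  shows "acl X \<inter> active = X"
proof -
  have "X \<subseteq> acl X"
    using acl_closed_acl[of X] assms active_subset by (auto simp: acl_closed_def)
  moreover have "v \<in> X" if "v \<in> acl X" "v \<in> active" for v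
    using acl_smaller_neighbour[OF assms that(1)] that(2) by (auto simp: active_def dest: less_asym)
  ultimately show ?thesis using assms by blast
qed

lemma acl_empty [simp]: "acl {} = {}"
proof -
  have "acl_closed {} {}" by (auto simp: acl_closed_def P_closed_def)
  then show ?thesis using acl_least by blast
qed

text \<open>Every \<open>v\<close> in \<open>H\<close> other than \<open>a\<close> has a smaller
  neighbour in \<open>H\<close>. If \<open>v\<close> is in \<open>P\<close>, the second rule did not
  put it into \<open>acl X\<close>, so some smaller neighbour is outside \<open>acl X\<close>, yet
  inside the larger closure. If \<open>v\<close> is in \<open>Q\<close>, its smaller neighbour in
  the larger closure is in \<open>P\<close>, and in \<open>acl X\<close> it would have brought
  \<open>v\<close> along.\<close>

lemma acl_difference_uniactive:
  assumes "insert a X \<subseteq> active" "a \<notin> X"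
  defines "H \<equiv> acl (insert a X) - acl X"
  shows "local_min P H = {a}" "local_min Q H = {}" "Min H = a" "acl X \<subset> acl (insert a X)"
proof -
  have Y: "insert a X \<subseteq> P \<union> Q" and X: "X \<subseteq> active" using assms(1) active_subset by auto
  have clY: "acl_closed (insert a X) (acl (insert a X))" using acl_closed_acl[OF Y] .
  have clX: "acl_closed X (acl X)" using acl_closed_acl Y by auto
  have sub: "acl X \<subseteq> acl (insert a X)" using acl_mono[OF subset_insertI Y] .
  have a: "a \<in> H"
    using acl_Int_active[OF X] clY assms(1,2) by (auto simp: H_def acl_closed_def)
  then show "acl X \<subset> acl (insert a X)" using sub by (auto simp: H_def)
  have smaller: "\<exists>w\<in>H. adj v w \<and> w < v" if v: "v \<in> H" "v \<noteq> a" for v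
  proof -
    have "v \<notin> X"
      using v clX by (auto simp: H_def acl_closed_def)
    then have "\<exists>w\<in>acl (insert a X). adj v w \<and> w < v"
      using acl_smaller_neighbour[OF assms(1), of v] v by (auto simp: H_def)
    then obtain w where w: "w \<in> acl (insert a X)" "adj v w" "w < v" by blast
    show ?thesis
    proof (cases "v \<in> P")
      case True
      then obtain u where "adj v u" "u < v" "u \<notin> acl X"
        using clX v w by (auto simp: acl_closed_def H_def)
      then show ?thesis
        using clY True v by (auto simp: H_def acl_closed_def P_closed_def)
    next
      case False
      then have "w \<in> P" using w(2) adj_bipartite by blast
      then have "w \<notin> acl X"
        using clX v adj_sym[OF w(2)] by (auto simp: acl_closed_def P_closed_def H_def)
      then show ?thesis using w by (auto simp: H_def)
    qed
  qed
  have "\<not> (\<forall>w\<in>H. adj v w \<longrightarrow> v < w)" if "v \<in> H" "v \<noteq> a" for v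
    using smaller[OF that] by (auto dest: less_asym)
  moreover have aP: "a \<in> P" "\<forall>w. adj a w \<longrightarrow> a < w" using assms(1) by (auto simp: active_def)
  moreover have "a \<notin> Q" using aP disjoint by blast
  ultimately show "local_min P H = {a}" "local_min Q H = {}"
    using a unfolding local_min_def by blast+
  have fin: "finite H"
    using clY finite_P finite_Q finite_subset[of H "P \<union> Q"]
    by (auto simp: H_def acl_closed_def P_closed_def)
  have "Min H \<in> H" using fin a Min_in by blast
  then show "Min H = a"
    using smaller[of "Min H"] fin by (meson Min_le leD)
qed

section \<open>Existence and uniqueness of uniactive chains\<close>

lemma uniactive_chain_acl:
  defines "as \<equiv> sorted_list_of_set active"
  shows "uniactive_chain (map (\<lambda>k. acl (set (drop k as))) [0..<Suc (length as)])"
    (is "uniactive_chain ?D")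
proof -
  have as: "set as = active" "sorted_wrt (<) as" "distinct as"
    using finite_active by (auto simp: as_def)
  have nth: "?D ! k = acl (set (drop k as))" if "k \<le> length as" for k
    using that by (auto simp: nth_append simp del: upt_Suc)
  have len: "length ?D = Suc (length as)" by simp
  have sub: "set (drop k as) \<subseteq> active" for k
    using set_drop_subset[of k as] as(1) by auto
  have step: "local_min P (?D ! k - ?D ! Suc k) = {as ! k} \<and> local_min Q (?D ! k - ?D ! Suc k) = {} \<and>
      Min (?D ! k - ?D ! Suc k) = as ! k \<and> ?D ! Suc k \<subset> ?D ! k" if "k < length as" for k
  proof -
    have "set (drop k as) = insert (as ! k) (set (drop (Suc k) as))"
      using that by (metis Cons_nth_drop_Suc list.simps(15))
    moreover have "as ! k \<notin> set (drop (Suc k) as)"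
      using that as(3) by (metis Cons_nth_drop_Suc distinct.simps(2) distinct_drop)
    ultimately show ?thesis
      using acl_difference_uniactive[of "as ! k" "set (drop (Suc k) as)"] sub[of k] that nth by simp
  qed
  have "P_closed A" if A: "A \<in> set ?D" for A
  proof -
    obtain k where "A = acl (set (drop k as))" using A unfolding set_map by blast
    then show ?thesis
      using acl_closed_acl[of "set (drop k as)"] sub[of k] active_subset by (auto simp: acl_closed_def)
  qed
  \<comment> \<open>At index \<open>length as\<close> the dropped list is empty, and
    \<open>acl {}\<close> is empty.\<close>
  moreover have "last ?D = {}" by simp
  moreover have "as ! i < as ! j" if "i < j" "j < length as" for i j
    using that as(2) by (simp add: sorted_wrt_nth_less)
  ultimately show ?thesis
    unfolding uniactive_chain_def using step len by (simp del: upt_Suc)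
qed

lemma uniactive_chainD:
  assumes "uniactive_chain D"
  shows "D \<noteq> []" "last D = {}" "\<And>A. A \<in> set D \<Longrightarrow> P_closed A"
  using assms unfolding uniactive_chain_def by blast+

text \<open>Followed along the list from position \<open>j\<close>, a vertex must disappear before
  the end, where the set is empty; its first disappearance gives the piece.\<close>

lemma chain_piece:
  assumes "D \<noteq> []" "last D = {}" "j < length D" "v \<in> D ! j"
  shows "\<exists>k\<ge>j. Suc k < length D \<and> v \<in> D ! k - D ! Suc k"
  using assms(3,4)
proof (induction "length D - j" arbitrary: j)
  case 0
  then show ?case by simp
next
  case (Suc n)
  have "Suc j < length D"
    using Suc.prems assms(1,2) by (metis Suc_lessI diff_Suc_1 empty_iff last_conv_nth)
  show ?case
  proof (cases "v \<in> D ! Suc j")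
    case True
    moreover have "n = length D - Suc j" using Suc.hyps(2) by linarith
    ultimately show ?thesis
      using Suc.hyps(1)[of "Suc j"] \<open>Suc j < length D\<close> Suc_leD by blast
  next
    case False
    then show ?thesis using Suc.prems \<open>Suc j < length D\<close> by auto
  qed
qed

text \<open>
  Every vertex of a piece other than its minimum has a smaller neighbour in that piece. So the minima
  are the active vertices, and a minimal vertex missing from the active closure cannot exist.
\<close>

lemma uniactive_chain_unique:
  assumes D: "uniactive_chain D"
    and outside: "\<And>v. v \<in> P \<Longrightarrow> v \<notin> D ! 0 \<Longrightarrow> \<exists>w. w \<notin> D ! 0 \<and> adj v w \<and> w < v"
  defines "as \<equiv> sorted_list_of_set active"
  shows "D = map (\<lambda>k. acl (set (drop k as))) [0..<Suc (length as)]"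
proof -
  define n where "n = length D - 1"
  define H where "H k = D ! k - D ! Suc k" for k
  define p where "p k = Min (H k)" for k
  have len: "length D = Suc n" using D by (auto simp: uniactive_chain_def n_def)
  have last: "D ! n = {}" using D len by (auto simp: uniactive_chain_def last_conv_nth)
  have closed: "P_closed (D ! k)" if "k \<le> n" for k
    using D len that by (auto simp: uniactive_chain_def)
  have psub: "D ! Suc k \<subset> D ! k" and card: "card (local_min P (H k)) = 1"
    and Qempty: "local_min Q (H k) = {}" if "k < n" for k
    using D len that by (auto simp: uniactive_chain_def H_def)
  have p_mono: "p i < p j" if "i < j" "j < n" for i j
    using D len that by (auto simp: uniactive_chain_def p_def H_def)
  have anti: "D ! j \<subseteq> D ! i" if "i \<le> j" "j \<le> n" for i j
    using that
  proof (induction j rule: dec_induct)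
    case (step j)
    then show ?case using psub[of j] by auto
  qed simp
  have piece: "\<exists>k\<ge>j. k < n \<and> v \<in> H k" if "j \<le> n" "v \<in> D ! j" for v j
    using chain_piece[of D j v] D len that by (auto simp: uniactive_chain_def H_def)
  have fin: "finite (H k)" if "k < n" for k
    using closed[of k] that finite_P finite_Q finite_subset[of "H k" "P \<union> Q"]
    by (auto simp: P_closed_def H_def)
  have p_in: "p k \<in> H k" if "k < n" for k
    using Min_in[OF fin[OF that]] psub[OF that] by (auto simp: p_def H_def)
  have p_le: "p k \<le> v" if "k < n" "v \<in> H k" for k v
    using that fin by (simp add: p_def)
  \<comment> \<open>The minimum of a piece is a local minimum on whichever side it lies. Side
    \<open>Q\<close> has none, so it is the single one on side \<open>P\<close>.\<close>
  have p_min: "local_min P (H k) = {p k}" if k: "k < n" for k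
  proof -
    have "\<forall>w\<in>H k. adj (p k) w \<longrightarrow> p k < w"
      using p_le[OF k] adj_neq by (metis order_le_imp_less_or_eq)
    moreover have "p k \<in> P \<union> Q"
      using closed[of k] p_in[OF k] k by (auto simp: P_closed_def H_def)
    ultimately have "p k \<in> local_min P (H k)"
      using Qempty[OF k] p_in[OF k] by (auto simp: local_min_def)
    then show ?thesis using card[OF k] by (auto simp: card_1_singleton_iff)
  qed
  \<comment> \<open>Since the minima increase along the chain, \<open>p k\<close> is least in all of
    \<open>D ! k\<close>, not just in its own piece. As \<open>D ! k\<close> is closed, it contains
    all neighbours of \<open>p k\<close>, whence \<open>p k\<close> is active.\<close>
  have p_least: "p k \<le> v" if kv: "k < n" "v \<in> D ! k" for k v
  proof -
    obtain j where j: "k \<le> j" "j < n" "v \<in> H j" using piece[OF less_imp_le[OF kv(1)] kv(2)] by blast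
    then have "p k \<le> p j" using p_mono[of k j] by (cases "k = j") auto
    then show ?thesis using p_le[of j v] j by auto
  qed
  have p_active: "p k \<in> active" if k: "k < n" for k
  proof -
    have "p k \<in> P \<inter> D ! k" using p_min[OF k] by (auto simp: local_min_def H_def)
    moreover from this have "p k < w" if "adj (p k) w" for w
      using closed[of k] k that p_least[OF k, of w] adj_neq[OF that]
      by (auto simp: P_closed_def)
    ultimately show ?thesis by (auto simp: active_def)
  qed
  have smaller: "\<exists>w\<in>H k. adj v w \<and> w < v" if "k < n" "v \<in> H k" "v \<noteq> p k" for k v
  proof -
    have "v \<in> P \<or> v \<in> Q" using that closed[of k] by (auto simp: P_closed_def H_def)
    then show ?thesis
      using not_local_min_smaller[of v P "H k"] not_local_min_smaller[of v Q "H k"]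
        p_min[of k] Qempty[of k] that by auto
  qed
  have active_eq: "active = p ` {0..<n}"
  proof
    show "active \<subseteq> p ` {0..<n}"
    proof
      fix v assume v: "v \<in> active"
      then have "v \<in> D ! 0"
        using outside[of v] by (auto simp: active_def dest: less_asym)
      then obtain k where k: "k < n" "v \<in> H k" using piece[of 0 v] by auto
      then have "v = p k"
        using smaller[of k v] v by (auto simp: active_def dest: less_asym)
      then show "v \<in> p ` {0..<n}" using k by auto
    qed
  qed (use p_active in auto)
  have "sorted_wrt (<) (map p [0..<n])"
    using p_mono by (auto simp: sorted_wrt_iff_nth_less)
  then have "sorted_list_of_set (set (map p [0..<n])) = map p [0..<n]"
    by (intro sorted_list_of_set.idem_if_sorted_distinct) (auto simp: strict_sorted_iff)
  then have as: "as = map p [0..<n]" by (simp add: as_def active_eq)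
  have "D ! k = acl (set (drop k as))" if k: "k \<le> n" for k
  proof -
    have X: "set (drop k as) = p ` {k..<n}"
      unfolding as drop_map by (simp add: drop_upt)
    have Xa: "p ` {k..<n} \<subseteq> active" using p_active by auto
    define A where "A = acl (p ` {k..<n})"
    have cl: "acl_closed (p ` {k..<n}) A"
      unfolding A_def using acl_closed_acl Xa active_subset by blast
    have "acl_closed (p ` {k..<n}) (D ! k)"
      unfolding acl_closed_def
    proof (intro conjI ballI impI)
      show "P_closed (D ! k)" using closed k .
      show "p ` {k..<n} \<subseteq> D ! k"
        using p_in anti by (fastforce simp: H_def)
      fix v assume v: "v \<in> P" "\<exists>w. adj v w \<and> w < v" "\<forall>w. adj v w \<longrightarrow> w < v \<longrightarrow> w \<in> D ! k"
      show "v \<in> D ! k"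
      proof (rule ccontr)
        assume nv: "v \<notin> D ! k"
        show False
        proof (cases "v \<in> D ! 0")
          case False
          then show False using outside[of v] v anti[of 0 k] k by blast
        next
          case True
          \<comment> \<open>The piece of \<open>v\<close> precedes position \<open>k\<close>. There
            \<open>v\<close> has a smaller neighbour, which lies outside \<open>D ! k\<close> like
            the whole piece, against the assumption on the smaller neighbours of
            \<open>v\<close>.\<close>
          then obtain j where j: "j < n" "v \<in> H j" using piece[of 0 v] by auto
          have "j < k"
            using j nv anti[of k j] by (force simp: H_def not_less)
          have "v \<noteq> p j"
            using p_active[OF j(1)] v(2) by (auto simp: active_def dest: less_asym)
          then obtain w where "w \<in> H j" "adj v w" "w < v" using smaller j by blast
          then show False
            using v(3) anti[of "Suc j" k] \<open>j < k\<close> k by (auto simp: H_def)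
        qed
      qed
    qed
    then have "A \<subseteq> D ! k" unfolding A_def by (rule acl_least)
    moreover have "D ! k \<subseteq> A"
    proof (rule ccontr)
      assume "\<not> D ! k \<subseteq> A"
      then have ne: "D ! k - A \<noteq> {}" by auto
      have fin': "finite (D ! k - A)"
        using closed[OF k] finite_P finite_Q finite_subset[of "D ! k" "P \<union> Q"]
        by (auto simp: P_closed_def)
      define v where "v = Min (D ! k - A)"
      have v: "v \<in> D ! k" "v \<notin> A" using Min_in[OF fin' ne] by (auto simp: v_def)
      have below: "w \<in> A" if "w \<in> D ! k" "w < v" for w
        using that Min_le[OF fin', of w] by (fastforce simp: v_def)
      obtain j where j: "k \<le> j" "j < n" "v \<in> H j" using piece[OF k v(1)] by auto
      have "p j \<in> A" using j by (intro subsetD[OF acl_closed_contains[OF cl]] imageI) simp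
      then have "v \<noteq> p j" using v by blast
      then obtain w where w: "w \<in> H j" "adj v w" "w < v" using smaller j by blast
      have wD: "w \<in> D ! k" using w(1) anti[of k j] j by (auto simp: H_def)
      show False
      \<comment> \<open>Minimality of \<open>v\<close> puts every smaller neighbour of it in
        \<open>D ! k\<close> into \<open>A\<close>. On side \<open>P\<close> the second closure rule
        then yields \<open>v\<close>; on side \<open>Q\<close> the neighbour \<open>w\<close> is in
        \<open>P\<close> and the first rule does.\<close>
      proof (cases "v \<in> P")
        case True
        then have "u \<in> A" if "adj v u" "u < v" for u
          using below that closed[OF k] v(1) by (auto simp: P_closed_def)
        then show False
          using cl True v(2) w by (auto simp: acl_closed_def)
      next
        case False
        then have "w \<in> P" using w(2) adj_bipartite by blast
        then show False
          using below[OF wD w(3)] cl v(2) adj_sym[OF w(2)]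
          by (auto simp: acl_closed_def P_closed_def)
      qed
    qed
    ultimately show ?thesis by (simp add: X A_def)
  qed
  moreover have "length as = n" by (simp add: as)
  ultimately show ?thesis
    by (intro nth_equalityI) (auto simp: len simp del: upt_Suc)
qed

text \<open>The two descriptions of \<open>F_c\<close> agree because the two closures partition the
  vertices. A least common vertex would have a smaller neighbour in the closure of the opposite
  side, and its own side's rule puts that neighbour into both. A least uncovered vertex is not
  active; its smaller neighbours are covered, and none is in the opposite closure, which would
  otherwise contain the vertex too, so the second rule of its own side applies.\<close>

lemma P_Un_Q_diff_acl_active:
  "(P \<union> Q) - acl active = fundamental_graph.acl Q P adj (fundamental_graph.active Q adj)"
proof -
  interpret dual: fundamental_graph Q P adj
    using finite_P finite_Q disjoint adj_sym adj_bipartite by unfold_locales blast+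
  let ?A = "acl active" and ?A' = "dual.acl dual.active"
  have cl: "acl_closed active ?A" using acl_closed_acl active_subset by blast
  have cl': "dual.acl_closed dual.active ?A'"
    using dual.acl_closed_acl dual.active_subset by blast
  have fin: "finite (P \<union> Q)" using finite_P finite_Q by simp
  have disj: "?A \<inter> ?A' = {}"
  proof (rule ccontr)
    let ?S = "?A \<inter> ?A'"
    assume ne: "?S \<noteq> {}"
    have finS: "finite ?S"
      using cl fin finite_subset[of ?S "P \<union> Q"] by (auto simp: acl_closed_def P_closed_def)
    define v where "v = Min ?S"
    have v: "v \<in> ?A" "v \<in> ?A'" using Min_in[OF finS ne] by (auto simp: v_def)
    have below: "\<not> w < v" if "w \<in> ?S" for w
      using Min_le[OF finS that] by (simp add: v_def not_less)
    show False
    proof (cases "v \<in> P")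
      case True
      then have "v \<notin> dual.active" using dual.active_subset disjoint by blast
      then obtain w where "w \<in> ?A'" "adj v w" "w < v"
        using dual.acl_smaller_neighbour v by blast
      then show False using below[of w] acl_closed_neighbour[OF cl True v(1)] by blast
    next
      case False
      then have "v \<notin> active" "v \<in> Q"
        using active_subset cl v by (auto simp: acl_closed_def P_closed_def)
      then obtain w where "w \<in> ?A" "adj v w" "w < v"
        using acl_smaller_neighbour v by blast
      then show False using below[of w] dual.acl_closed_neighbour[OF cl' \<open>v \<in> Q\<close> v(2)] by blast
    qed
  qed
  have cover: "P \<union> Q \<subseteq> ?A \<union> ?A'"
  proof (rule ccontr)
    let ?S = "(P \<union> Q) - (?A \<union> ?A')"
    assume "\<not> ?thesis"
    then have ne: "?S \<noteq> {}" by blast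
    have finS: "finite ?S" using fin by simp
    define v where "v = Min ?S"
    have v: "v \<in> P \<union> Q" "v \<notin> ?A" "v \<notin> ?A'" using Min_in[OF finS ne] by (auto simp: v_def)
    have below: "w \<in> ?A \<union> ?A'" if "adj v w" "w < v" for w
      using Min_le[OF finS, of w] that adj_bipartite[of v w] by (fastforce simp: v_def not_le)
    show False
    proof (cases "v \<in> P")
      case True
      obtain w where w: "adj v w" "w < v"
        using not_active_smaller[OF True] cl v(2) by (auto simp: acl_closed_def)
      have "u \<notin> ?A'" if "adj v u" for u
        using cl' v(3) adj_sym[OF that] that True adj_bipartite[of v u] disjoint
        by (auto simp: dual.acl_closed_def dual.P_closed_def)
      then show False using below w True cl v(2) by (auto simp: acl_closed_def)
    next
      case False
      then have Q: "v \<in> Q" using v by auto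
      obtain w where w: "adj v w" "w < v"
        using dual.not_active_smaller[OF Q] cl' v(3) by (auto simp: dual.acl_closed_def)
      have "u \<notin> ?A" if "adj v u" for u
        using cl v(2) adj_sym[OF that] that Q adj_bipartite[of v u] disjoint
        by (auto simp: acl_closed_def P_closed_def)
      then show False using below w Q cl' v(3) by (auto simp: dual.acl_closed_def)
    qed
  qed
  have "?A' \<subseteq> P \<union> Q" using cl' by (auto simp: dual.acl_closed_def dual.P_closed_def)
  then show ?thesis using disj cover by blast
qed

end

section \<open>Matroids, duals and minors\<close>

lemma matroid_finite_ground: "matroid M \<Longrightarrow> finite (ground M)"
  by (simp add: matroid_def)

lemma indep_subset_ground: "matroid M \<Longrightarrow> indep M X \<Longrightarrow> X \<subseteq> ground M"
  by (simp add: matroid_def)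

lemma indep_empty: "matroid M \<Longrightarrow> indep M {}"
  by (simp add: matroid_def)

lemma indep_mono:
  assumes "matroid M" "indep M Y" "X \<subseteq> Y"
  shows "indep M X"
proof -
  have "\<forall>X Y. indep M Y \<longrightarrow> X \<subseteq> Y \<longrightarrow> indep M X"
    using assms(1) unfolding matroid_def by (elim conjE)
  then show ?thesis using assms(2,3) by blast
qed

lemma indep_finite: "matroid M \<Longrightarrow> indep M X \<Longrightarrow> finite X"
  using finite_subset[OF indep_subset_ground matroid_finite_ground] by blast

lemma indep_augment:
  assumes "matroid M" "indep M X" "indep M Y" "card X < card Y"
  shows "\<exists>e\<in>Y - X. indep M (insert e X)"
proof -
  have "\<forall>X Y. indep M X \<longrightarrow> indep M Y \<longrightarrow> card X < card Y \<longrightarrow> (\<exists>e\<in>Y - X. indep M (insert e X))"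
    using assms(1) unfolding matroid_def by (elim conjE)
  then show ?thesis using assms(2-) by blast
qed

lemma matroidI:
  assumes "finite (ground M)" "\<And>X. indep M X \<Longrightarrow> X \<subseteq> ground M" "indep M {}"
    "\<And>X Y. indep M Y \<Longrightarrow> X \<subseteq> Y \<Longrightarrow> indep M X"
    "\<And>X Y. indep M X \<Longrightarrow> indep M Y \<Longrightarrow> card X < card Y \<Longrightarrow> \<exists>e\<in>Y - X. indep M (insert e X)"
  shows "matroid M"
  unfolding matroid_def by (intro conjI allI impI) (fact assms | assumption | rule assms)+

lemma indep_extend:
  assumes M: "matroid M" and "indep M X" "indep M Y" "card X \<le> card Y"
  shows "\<exists>I. indep M I \<and> X \<subseteq> I \<and> I \<subseteq> X \<union> Y \<and> card I = card Y"
  using assms(2-)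
proof (induction "card Y - card X" arbitrary: X)
  case 0
  then show ?case by (intro exI[of _ X]) auto
next
  case (Suc n)
  have "card X < card Y" using Suc.hyps(2) by linarith
  then obtain e where e: "e \<in> Y - X" "indep M (insert e X)"
    using indep_augment[OF M Suc.prems(1,2)] by blast
  have "card (insert e X) = Suc (card X)"
    using e indep_finite[OF M Suc.prems(1)] by simp
  then have "n = card Y - card (insert e X)" "card (insert e X) \<le> card Y"
    using Suc.hyps(2) by linarith+
  then obtain I where "indep M I" "insert e X \<subseteq> I" "I \<subseteq> insert e X \<union> Y" "card I = card Y"
    using Suc.hyps(1)[of "insert e X"] e(2) Suc.prems(2) by blast
  then show ?case using e by (intro exI[of _ I]) auto
qed

lemma basis_indep: "basis M B \<Longrightarrow> indep M B"
  by (simp add: basis_def)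

lemma basis_maximal: "basis M B \<Longrightarrow> e \<notin> B \<Longrightarrow> \<not> indep M (insert e B)"
  unfolding basis_def by blast

lemma card_indep_le_basis:
  assumes "matroid M" "basis M B" "indep M X"
  shows "card X \<le> card B"
  using indep_augment[OF assms(1) basis_indep[OF assms(2)] assms(3)] basis_maximal[OF assms(2)]
  by (meson DiffD2 not_le)

lemma basis_iff_card:
  assumes "matroid M" "basis M B"
  shows "basis M X \<longleftrightarrow> indep M X \<and> card X = card B"
proof
  assume X: "basis M X"
  then show "indep M X \<and> card X = card B"
    using card_indep_le_basis[OF assms(1)] assms(2) by (meson basis_indep le_antisym)
next
  assume X: "indep M X \<and> card X = card B"
  have "Y = X" if "indep M Y" "X \<subseteq> Y" for Y
    using card_indep_le_basis[OF assms that(1)] that X indep_finite[OF assms(1)]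
    by (metis card_seteq)
  then show "basis M X" using X by (auto simp: basis_def)
qed

lemma basisI:
  assumes "matroid M" "indep M B" "\<And>e. e \<in> ground M - B \<Longrightarrow> \<not> indep M (insert e B)"
  shows "basis M B"
  unfolding basis_def
proof (intro conjI allI impI)
  fix X assume X: "indep M X" "B \<subseteq> X"
  show "X = B"
  proof (rule ccontr)
    assume "X \<noteq> B"
    then obtain e where e: "e \<in> X - B" using X by blast
    then have "indep M (insert e B)" using X indep_mono[OF assms(1) X(1)] by auto
    then show False using assms(3) e indep_subset_ground[OF assms(1) X(1)] by blast
  qed
qed (fact assms(2))

lemma basis_exists_above:
  assumes M: "matroid M" and "indep M X"
  shows "\<exists>B. basis M B \<and> X \<subseteq> B"
proof -
  have "finite {I. indep M I \<and> X \<subseteq> I}"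
    using indep_subset_ground[OF M] matroid_finite_ground[OF M]
    by (auto intro: rev_finite_subset[of "Pow (ground M)"])
  then obtain B where "B \<in> {I. indep M I \<and> X \<subseteq> I}"
      and max: "\<And>I. I \<in> {I. indep M I \<and> X \<subseteq> I} \<Longrightarrow> B \<subseteq> I \<Longrightarrow> B = I"
    using finite_has_maximal[of "{I. indep M I \<and> X \<subseteq> I}"] assms(2) by auto
  then show ?thesis
    by (intro exI[of _ B]) (auto simp: basis_def)
qed

section \<open>Circuits and fundamental circuits\<close>

lemma circuit_subset_ground: "circuit M C \<Longrightarrow> C \<subseteq> ground M"
  by (simp add: circuit_def)

lemma circuit_dependent: "circuit M C \<Longrightarrow> \<not> indep M C"
  by (simp add: circuit_def)

lemma circuit_remove_indep: "circuit M C \<Longrightarrow> e \<in> C \<Longrightarrow> indep M (C - {e})"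
  unfolding circuit_def by blast

lemma dependent_contains_circuit:
  assumes M: "matroid M" and "X \<subseteq> ground M" "\<not> indep M X"
  shows "\<exists>C. circuit M C \<and> C \<subseteq> X"
proof -
  have "finite X" using assms matroid_finite_ground finite_subset by blast
  then have "finite {Y. Y \<subseteq> X \<and> \<not> indep M Y}" by simp
  then obtain C where C: "C \<subseteq> X" "\<not> indep M C"
      and min: "\<And>Y. Y \<in> {Y. Y \<subseteq> X \<and> \<not> indep M Y} \<Longrightarrow> Y \<subseteq> C \<Longrightarrow> C = Y"
    using finite_has_minimal[of "{Y. Y \<subseteq> X \<and> \<not> indep M Y}"] assms(3) by auto
  have "circuit M C"
    unfolding circuit_def using C min assms(2) by blast
  then show ?thesis using C by blast
qed

text \<open>Existence, uniqueness and an exchange formula for the fundamental circuit at once. For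
  \<open>b\<close> in \<open>C\<close> other than \<open>e\<close>, extend \<open>C - {b}\<close>
  from \<open>B\<close> to the size of a basis. The extension cannot contain \<open>b\<close>, since
  it would contain \<open>C\<close>, so by cardinality it is
  \<open>insert e (B - {b})\<close>.\<close>

lemma circuit_in_insert_basis_iff:
  assumes M: "matroid M" and B: "basis M B" and e: "e \<in> ground M - B"
  shows "circuit M C \<and> C \<subseteq> insert e B \<longleftrightarrow> C = insert e {b \<in> B. indep M (insert e (B - {b}))}"
proof -
  have eq: "C = insert e {b \<in> B. indep M (insert e (B - {b}))}"
    if C: "circuit M C" "C \<subseteq> insert e B" for C
  proof
    have "e \<in> C"
      using C circuit_dependent indep_mono[OF M basis_indep[OF B]] by blast
    moreover have "indep M (insert e (B - {b}))" if b: "b \<in> C" "b \<noteq> e" for b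
    proof -
      have indep: "indep M (C - {b})" using circuit_remove_indep[OF C(1) b(1)] .
      then obtain I where I: "indep M I" "C - {b} \<subseteq> I" "I \<subseteq> C - {b} \<union> B" "card I = card B"
        using indep_extend[OF M indep basis_indep[OF B]] card_indep_le_basis[OF M B indep] by blast
      have "b \<notin> I"
        using I circuit_dependent[OF C(1)] indep_mono[OF M I(1), of C] by blast
      then have "I \<subseteq> insert e (B - {b})" using I C by blast
      moreover have "finite B" "b \<in> B" using indep_finite[OF M basis_indep[OF B]] b C by auto
      moreover have "card (insert e (B - {b})) = card B"
        using calculation e by (metis DiffD1 DiffD2 card_Suc_Diff1 card_insert_disjoint finite_Diff)
      ultimately have "I = insert e (B - {b})" using I(4) card_subset_eq by (metis finite_Diff finite_insert)
      then show ?thesis using I by simp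
    qed
    ultimately show "C \<subseteq> insert e {b \<in> B. indep M (insert e (B - {b}))}" using C by blast
    have "b \<in> C" if "b \<in> B" "indep M (insert e (B - {b}))" for b
      using that C circuit_dependent[OF C(1)] indep_mono[OF M that(2), of C] by blast
    then show "insert e {b \<in> B. indep M (insert e (B - {b}))} \<subseteq> C" using \<open>e \<in> C\<close> by blast
  qed
  have "insert e B \<subseteq> ground M" "\<not> indep M (insert e B)"
    using e indep_subset_ground[OF M basis_indep[OF B]] basis_maximal[OF B] by auto
  then obtain C0 where "circuit M C0" "C0 \<subseteq> insert e B"
    using dependent_contains_circuit[OF M] by blast
  then show ?thesis using eq by blast
qed

lemma fund_circuit_eq:
  assumes "matroid M" "basis M B" "e \<in> ground M - B"
  shows "fund_circuit M B e = insert e {b \<in> B. indep M (insert e (B - {b}))}"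
  unfolding fund_circuit_def circuit_in_insert_basis_iff[OF assms] by simp

section \<open>The dual matroid and fundamental cocircuits\<close>

lemma matroid_dual:
  assumes M: "matroid M"
  shows "matroid (dual M)"
proof -
  have "indep (dual M) {}"
    using basis_exists_above[OF M indep_empty[OF M]] by (auto simp: dual_def)
  moreover have "\<exists>e\<in>Y - X. indep (dual M) (insert e X)"
    if X: "indep (dual M) X" and Y: "indep (dual M) Y" and less: "card X < card Y" for X Y
  proof (rule ccontr)
    assume none: "\<not> ?thesis"
    obtain B where B: "basis M B" "X \<inter> B = {}" using X by (auto simp: dual_def)
    obtain B' where B': "basis M B'" "Y \<inter> B' = {}" using Y by (auto simp: dual_def)
    have XY: "X \<subseteq> ground M" "Y \<subseteq> ground M" using X Y by (auto simp: dual_def)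
    then have fin: "finite X" "finite Y" "finite B'"
      using matroid_finite_ground[OF M] finite_subset indep_finite[OF M basis_indep[OF B'(1)]] by auto
    have i: "indep M (B' - X)" using indep_mono[OF M basis_indep[OF B'(1)]] by auto
    \<comment> \<open>\<open>I\<close> keeps \<open>B' - X\<close> and is completed from
      \<open>B\<close>, so it avoids \<open>X\<close>. If augmentation fails, \<open>I\<close> also
      contains \<open>Y - X\<close>; comparing its size with that of \<open>B'\<close> gives
      \<open>card (Y - X) \<le> card (B' \<inter> X)\<close>, although \<open>B' \<inter> X\<close>
      lies in the smaller set \<open>X - Y\<close>.\<close>
    obtain I where I: "indep M I" "B' - X \<subseteq> I" "I \<subseteq> B' - X \<union> B" "card I = card B"
      using indep_extend[OF M i basis_indep[OF B(1)] card_indep_le_basis[OF M B(1) i]] by blast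
    have "basis M I" using basis_iff_card[OF M B(1)] I by blast
    moreover have "X \<inter> I = {}" using I B by blast
    ultimately have "indep (dual M) (insert e X)" if "e \<in> Y - X" "e \<notin> I" for e
      using that XY by (auto simp: dual_def)
    then have "Y - X \<subseteq> I" using none by blast
    then have "card ((B' - X) \<union> (Y - X)) \<le> card I"
      using I indep_finite[OF M] by (intro card_mono) auto
    moreover have "card ((B' - X) \<union> (Y - X)) = card (B' - X) + card (Y - X)"
      using B' fin by (intro card_Un_disjoint) auto
    moreover have "card I = card B'" using I basis_iff_card[OF M B(1)] B' by auto
    moreover have "card B' = card (B' - X) + card (B' \<inter> X)"
      using fin by (metis add.commute card_Int_Diff)
    moreover have "card (B' \<inter> X) \<le> card (X - Y)"
      using B' fin by (intro card_mono) auto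
    moreover have "card (X - Y) < card (Y - X)"
      using less fin card_Int_Diff[of X Y] card_Int_Diff[of Y X] by (simp add: Int_commute)
    ultimately show False by linarith
  qed
  moreover have "finite (ground (dual M))" using matroid_finite_ground[OF M] by (simp add: dual_def)
  moreover have "indep (dual M) X" if "indep (dual M) Y" "X \<subseteq> Y" for X Y
    using that by (auto simp: dual_def)
  moreover have "X \<subseteq> ground (dual M)" if "indep (dual M) X" for X
    using that by (auto simp: dual_def)
  ultimately show ?thesis by (intro matroidI)
qed

lemma basis_dual:
  assumes M: "matroid M" and B: "basis M B"
  shows "basis (dual M) (ground M - B)"
proof (rule basisI[OF matroid_dual[OF M]])
  show "indep (dual M) (ground M - B)" using B by (auto simp: dual_def)
  fix e assume e: "e \<in> ground (dual M) - (ground M - B)"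
  show "\<not> indep (dual M) (insert e (ground M - B))"
  proof
    assume "indep (dual M) (insert e (ground M - B))"
    then obtain B' where B': "basis M B'" "insert e (ground M - B) \<inter> B' = {}" by (auto simp: dual_def)
    then have "B' \<subseteq> B - {e}" using indep_subset_ground[OF M basis_indep] by blast
    moreover have "e \<in> B" using e by (auto simp: dual_def)
    ultimately have "B' \<subset> B" by blast
    then show False using B' B by (auto simp: basis_def)
  qed
qed

text \<open>A fundamental cocircuit is a fundamental circuit of the complementary basis in the dual.
  The dual exchange condition asks for a basis avoiding \<open>b\<close> and all elements outside
  \<open>B\<close> except \<open>e\<close>; by cardinality only \<open>insert e (B - {b})\<close>
  qualifies. So circuits and cocircuits share one exchange condition.\<close>

lemma fund_cocircuit_eq:
  assumes M: "matroid M" and B: "basis M B" and b: "b \<in> B"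
  shows "fund_cocircuit M B b = insert b {e \<in> ground M - B. indep M (insert e (B - {b}))}"
proof -
  have bg: "B \<subseteq> ground M" "finite B"
    using B M basis_indep indep_subset_ground indep_finite by blast+
  have "indep (dual M) (insert b (ground M - B - {e})) \<longleftrightarrow> indep M (insert e (B - {b}))"
    if e: "e \<in> ground M - B" for e
  proof -
    have card: "card (insert e (B - {b})) = card B"
      using e b bg by (metis DiffD1 DiffD2 card_Suc_Diff1 card_insert_disjoint finite_Diff)
    have "B' = insert e (B - {b})" if "basis M B'" "insert b (ground M - B - {e}) \<inter> B' = {}" for B'
    proof (rule card_subset_eq)
      show "B' \<subseteq> insert e (B - {b})"
        using that indep_subset_ground[OF M basis_indep[OF that(1)]] by blast
      show "card B' = card (insert e (B - {b}))"
        using card that basis_iff_card[OF M B] by metis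
    qed (use bg in auto)
    moreover have "basis M (insert e (B - {b}))" if "indep M (insert e (B - {b}))"
      using that card basis_iff_card[OF M B] by blast
    moreover have "insert b (ground M - B - {e}) \<inter> insert e (B - {b}) = {}"
      using b e by blast
    ultimately have "(\<exists>B'. basis M B' \<and> insert b (ground M - B - {e}) \<inter> B' = {}) \<longleftrightarrow>
        indep M (insert e (B - {b}))"
      by (metis basis_indep)
    then show ?thesis
      using bg b by (auto simp: dual_def)
  qed
  moreover have "fund_cocircuit M B b = fund_circuit (dual M) (ground M - B) b"
    by (simp add: fund_cocircuit_def fund_circuit_def cocircuit_def)
  moreover have "b \<in> ground (dual M) - (ground M - B)"
    using b bg by (auto simp: dual_def)
  ultimately show ?thesis
    using fund_circuit_eq[OF matroid_dual[OF M] basis_dual[OF M B]] by auto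
qed

section \<open>Restrictions, contractions and minors\<close>

lemma ground_restriction [simp]: "ground (restriction M G) = G"
  and indep_restriction [simp]: "indep (restriction M G) X \<longleftrightarrow> X \<subseteq> G \<and> indep M X"
  by (simp_all add: restriction_def)

lemma restriction_restriction [simp]: "A \<subseteq> G \<Longrightarrow> restriction (restriction M G) A = restriction M A"
  by (auto simp: restriction_def)

lemma matroid_restriction:
  assumes M: "matroid M" and "G \<subseteq> ground M"
  shows "matroid (restriction M G)"
proof -
  have aug: "\<exists>e\<in>Y - X. indep (restriction M G) (insert e X)"
    if "indep (restriction M G) X" "indep (restriction M G) Y" "card X < card Y" for X Y
    using that indep_augment[OF M, of X Y] by auto
  show ?thesis
  proof (rule matroidI)
    show "finite (ground (restriction M G))"
      using finite_subset[OF assms(2) matroid_finite_ground[OF M]] by simp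
    show "indep (restriction M G) X" if "indep (restriction M G) Y" "X \<subseteq> Y" for X Y
      using that indep_mono[OF M, of Y X] by auto
  qed (use indep_empty[OF M] aug in auto)
qed

text \<open>Independence in a contraction does not depend on the chosen basis of \<open>A\<close>.
  Extend \<open>J'\<close> inside \<open>J' \<union> X \<union> J\<close> to the size of
  \<open>X \<union> J\<close>; maximality of \<open>J'\<close> in \<open>A\<close> keeps further
  elements of \<open>A\<close> out, so counting forces all of \<open>X\<close> in.\<close>

lemma indep_Un_basis_cong:
  assumes M: "matroid M" and A: "A \<subseteq> ground M"
    and J: "basis (restriction M A) J" and J': "basis (restriction M A) J'"
    and X: "X \<inter> A = {}" and indep: "indep M (X \<union> J)"
  shows "indep M (X \<union> J')"
proof -
  have MA: "matroid (restriction M A)" using matroid_restriction[OF M A] .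
  have sub: "J \<subseteq> A" "J' \<subseteq> A" "indep M J'" using J J' by (auto simp: basis_def)
  have card: "card J' = card J" using basis_iff_card[OF MA J] J' by blast
  have fin: "finite X" "finite J" "finite J'"
    using indep_finite[OF M indep] indep_finite[OF M sub(3)] by auto
  have cU: "card (X \<union> J) = card X + card J"
    using X sub fin by (intro card_Un_disjoint) auto
  then obtain I where I: "indep M I" "J' \<subseteq> I" "I \<subseteq> J' \<union> (X \<union> J)" "card I = card (X \<union> J)"
    using indep_extend[OF M sub(3) indep] card by auto
  have "indep (restriction M A) (I \<inter> A)" using indep_mono[OF M I(1)] by auto
  then have IA: "I \<inter> A = J'" using J' I sub by (auto simp: basis_def)
  then have IU: "I = (I \<inter> X) \<union> J'" using I sub X by blast
  have "card I \<le> card (I \<inter> X) + card J'"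
    using IU card_Un_le by metis
  then have "card X \<le> card (I \<inter> X)" using I(4) cU card by linarith
  then have "I \<inter> X = X" using fin by (meson Int_lower2 card_seteq)
  then have "X \<union> J' = I" using IU by blast
  then show ?thesis using I by simp
qed

lemma ground_minor [simp]: "ground (minor M G A) = G - A"
  by (simp add: minor_def contraction_def)

lemma indep_minor_iff:
  assumes M: "matroid M" and "A \<subseteq> G" "G \<subseteq> ground M" and J: "basis (restriction M A) J"
  shows "indep (minor M G A) X \<longleftrightarrow> X \<subseteq> G - A \<and> indep M (X \<union> J)"
proof -
  have "J \<subseteq> A" using J by (auto simp: basis_def)
  have *: "indep M (X \<union> J)" if "basis (restriction M A) J'" "indep M (X \<union> J')" "X \<subseteq> G - A" for J'
    using indep_Un_basis_cong[OF M _ that(1) J] that assms by blast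
  have "indep (minor M G A) X \<longleftrightarrow> X \<subseteq> G - A \<and>
      (\<exists>J. basis (restriction M A) J \<and> X \<union> J \<subseteq> G \<and> indep M (X \<union> J))"
    using assms(2) by (simp add: minor_def contraction_def)
  also have "\<dots> \<longleftrightarrow> X \<subseteq> G - A \<and> indep M (X \<union> J)"
    using * J \<open>J \<subseteq> A\<close> assms(2) by blast
  finally show ?thesis .
qed

lemma matroid_minor:
  assumes M: "matroid M" and AG: "A \<subseteq> G" "G \<subseteq> ground M"
  shows "matroid (minor M G A)"
proof -
  have MA: "matroid (restriction M A)" using matroid_restriction M AG by blast
  then obtain J where J: "basis (restriction M A) J"
    using basis_exists_above[OF MA indep_empty[OF MA]] by blast
  note iff = indep_minor_iff[OF M AG J]
  have JA: "J \<subseteq> A" "indep M J" using J by (auto simp: basis_def)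
  have "\<exists>e\<in>Y - X. indep (minor M G A) (insert e X)"
    if "indep (minor M G A) X" "indep (minor M G A) Y" "card X < card Y" for X Y
  proof -
    have XY: "X \<subseteq> G - A" "Y \<subseteq> G - A" "indep M (X \<union> J)" "indep M (Y \<union> J)"
      using that iff by auto
    then have "finite X" "finite Y" "finite J" using indep_finite[OF M] by fastforce+
    then have "card (X \<union> J) < card (Y \<union> J)"
      using XY JA that(3) card_Un_disjoint[of X J] card_Un_disjoint[of Y J] by fastforce
    then show ?thesis
      using indep_augment[OF M XY(3,4)] iff XY by auto
  qed
  moreover have "indep (minor M G A) {}" using iff JA by auto
  moreover have "indep (minor M G A) X" if "indep (minor M G A) Y" "X \<subseteq> Y" for X Y
    using that iff indep_mono[OF M, of "Y \<union> J" "X \<union> J"] by auto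
  moreover have "finite (G - A)"
    using AG matroid_finite_ground[OF M] finite_subset by blast
  moreover have "X \<subseteq> G - A" if "indep (minor M G A) X" for X using that iff by auto
  ultimately show ?thesis by (intro matroidI) simp_all
qed

text \<open>From minor to restriction this propagates spanning along a filtration; conversely it
  provides the bases of the minors between spanned sets.\<close>

lemma basis_restriction_minor_iff:
  assumes M: "matroid M" and AG: "A \<subseteq> G" "G \<subseteq> ground M"
    and A: "basis (restriction M A) (B \<inter> A)"
  shows "basis (minor M G A) (B \<inter> (G - A)) \<longleftrightarrow> basis (restriction M G) (B \<inter> G)"
proof -
  note iff = indep_minor_iff[OF M AG A]
  have MG: "matroid (restriction M G)" using matroid_restriction[OF M AG(2)] .
  have eq: "B \<inter> (G - A) \<union> B \<inter> A = B \<inter> G" using AG by blast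
  show ?thesis
  proof
    assume m: "basis (minor M G A) (B \<inter> (G - A))"
    show "basis (restriction M G) (B \<inter> G)"
    proof (rule basisI[OF MG])
      show "indep (restriction M G) (B \<inter> G)" using iff basis_indep[OF m] eq by auto
      fix e assume e: "e \<in> ground (restriction M G) - B \<inter> G"
      show "\<not> indep (restriction M G) (insert e (B \<inter> G))"
      proof
        assume i: "indep (restriction M G) (insert e (B \<inter> G))"
        show False
        proof (cases "e \<in> A")
          case True
          have "indep M (insert e (B \<inter> A))"
            using i indep_mono[OF M, of "insert e (B \<inter> G)" "insert e (B \<inter> A)"] AG by auto
          then show False using basis_maximal[OF A, of e] True e by auto
        next
          case False
          then have "indep (minor M G A) (insert e (B \<inter> (G - A)))"
            using i iff e eq by auto
          then show False using basis_maximal[OF m, of e] e by auto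
        qed
      qed
    qed
  next
    assume G: "basis (restriction M G) (B \<inter> G)"
    show "basis (minor M G A) (B \<inter> (G - A))"
    proof (rule basisI[OF matroid_minor[OF M AG]])
      show "indep (minor M G A) (B \<inter> (G - A))" using iff basis_indep[OF G] eq by auto
      fix e assume e: "e \<in> ground (minor M G A) - B \<inter> (G - A)"
      then show "\<not> indep (minor M G A) (insert e (B \<inter> (G - A)))"
        using iff basis_maximal[OF G, of e] eq by auto
    qed
  qed
qed

text \<open>
  If a maximal independent subset of $(C_1 \cup C_2) \setminus \{e\}$ contains $C_2 \setminus \{f\}$,
  then adding \<open>e\<close> to it makes it dependent, as all such subsets have the same size and one of them
  contains $C_1 \setminus \{e\}$.
\<close>

lemma strong_circuit_elimination:
  assumes M: "matroid M" and C1: "circuit M C1" and C2: "circuit M C2"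
    and f: "f \<in> C1 \<inter> C2" and e: "e \<in> C1 - C2"
  shows "\<exists>C. circuit M C \<and> C \<subseteq> C1 \<union> C2 - {f} \<and> e \<in> C"
proof -
  let ?Z = "C1 \<union> C2 - {e}"
  have Z: "?Z \<subseteq> ground M" using C1 C2 circuit_subset_ground by blast
  have MZ: "matroid (restriction M ?Z)" using matroid_restriction[OF M Z] .
  have "indep (restriction M ?Z) (C2 - {f})" using circuit_remove_indep[OF C2] f e by auto
  then obtain I where I: "basis (restriction M ?Z) I" "C2 - {f} \<subseteq> I"
    using basis_exists_above[OF MZ] by blast
  have "indep (restriction M ?Z) (C1 - {e})" using circuit_remove_indep[OF C1] f e by auto
  then obtain I' where I': "basis (restriction M ?Z) I'" "C1 - {e} \<subseteq> I'"
    using basis_exists_above[OF MZ] by blast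
  have iI: "indep M I" "I \<subseteq> ?Z" and iI': "indep M I'" "I' \<subseteq> ?Z" using I I' by (auto simp: basis_def)
  have fI: "f \<notin> I"
    using I(2) circuit_dependent[OF C2] indep_mono[OF M iI(1), of C2] by blast
  have "\<not> indep M (insert e I)"
  proof
    assume i: "indep M (insert e I)"
    have "card I = card I'" using basis_iff_card[OF MZ I(1)] I'(1) by auto
    then have "card I' < card (insert e I)" using iI(2) indep_finite[OF M iI(1)] by (subst card_insert_disjoint) auto
    then obtain x where x: "x \<in> insert e I - I'" "indep M (insert x I')"
      using indep_augment[OF M iI'(1) i] by blast
    show False
    proof (cases "x = e")
      case True
      then have "C1 \<subseteq> insert x I'" using I'(2) by blast
      then show False using circuit_dependent[OF C1] indep_mono[OF M x(2)] by blast
    next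
      case False
      then show False using x iI iI' basis_maximal[OF I'(1), of x] by auto
    qed
  qed
  then obtain C where C: "circuit M C" "C \<subseteq> insert e I"
    using dependent_contains_circuit[OF M, of "insert e I"] indep_subset_ground[OF M iI(1)]
      e circuit_subset_ground[OF C1] by blast
  moreover have "e \<in> C"
    using C circuit_dependent indep_mono[OF M iI(1), of C] by blast
  moreover have "C \<subseteq> C1 \<union> C2 - {f}" using C iI fI e f by blast
  ultimately show ?thesis by blast
qed

text \<open>In a counterexample with least union, eliminating a common \<open>f\<close> gives
  \<open>C3\<close> through \<open>e\<close> and \<open>C4\<close> through \<open>g\<close>. Each
  leaves the circuit it started from, so \<open>C4\<close> meets \<open>C1\<close>, and minimality
  makes \<open>C1 \<union> C4\<close> the whole union. Thus \<open>C4\<close> contains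
  \<open>C2 - C1\<close> and meets \<open>C3\<close>; but \<open>C3 \<union> C4\<close> misses
  \<open>f\<close> and contradicts minimality.\<close>

lemma circuit_through_two:
  assumes M: "matroid M"
  shows "circuit M C1 \<Longrightarrow> circuit M C2 \<Longrightarrow> C1 \<inter> C2 \<noteq> {} \<Longrightarrow> e \<in> C1 \<Longrightarrow> g \<in> C2 \<Longrightarrow>
    \<exists>C. circuit M C \<and> e \<in> C \<and> g \<in> C"
proof (induction "card (C1 \<union> C2)" arbitrary: C1 C2 rule: less_induct)
  case less
  note C1 = less.prems(1) and C2 = less.prems(2)
  show ?case
  proof (rule ccontr)
    assume none: "\<not> ?thesis"
    then have eg: "e \<in> C1 - C2" "g \<in> C2 - C1" using less.prems by blast+
    obtain f where f: "f \<in> C1" "f \<in> C2" using less.prems by blast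
    have fin: "finite (C1 \<union> C2)"
      using C1 C2 circuit_subset_ground matroid_finite_ground[OF M] finite_subset by (metis finite_UnI)
    have minimal: "D1 \<union> D2 = C1 \<union> C2"
      if "circuit M D1" "circuit M D2" "D1 \<inter> D2 \<noteq> {}" "e \<in> D1" "g \<in> D2" "D1 \<union> D2 \<subseteq> C1 \<union> C2" for D1 D2
      using that less.hyps[of D1 D2] none psubset_card_mono[OF fin, of "D1 \<union> D2"] by blast
    have not_sub: "\<not> D \<subseteq> C - {x}" if "circuit M D" "circuit M C" "x \<in> C" for D C x
      using that circuit_dependent indep_mono[OF M circuit_remove_indep] by blast
    obtain C3 where C3: "circuit M C3" "C3 \<subseteq> C1 \<union> C2 - {f}" "e \<in> C3"
      using strong_circuit_elimination[OF M C1 C2] f eg by blast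
    obtain C4 where C4: "circuit M C4" "C4 \<subseteq> C1 \<union> C2 - {f}" "g \<in> C4"
      using strong_circuit_elimination[OF M C2 C1, of f g] f eg by blast
    have "\<not> C3 \<subseteq> C1 - {f}" "\<not> C4 \<subseteq> C2 - {f}" using not_sub C1 C2 C3 C4 f by blast+
    then have ne: "C3 \<inter> (C2 - C1) \<noteq> {}" "C4 \<inter> (C1 - C2) \<noteq> {}" using C3 C4 by blast+
    have "C1 \<union> C4 = C1 \<union> C2" using minimal[of C1 C4] C1 C4 ne eg by blast
    then have "C2 - C1 \<subseteq> C4" by blast
    then have "C3 \<inter> C4 \<noteq> {}" using ne by blast
    then have "C3 \<union> C4 = C1 \<union> C2" using minimal[of C3 C4] C3 C4 by blast
    then show False using C3 C4 f by blast
  qed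
qed

section \<open>The fundamental graph of a basis\<close>

text \<open>The least element not sharing a circuit with \<open>p\<close> would share one with a
  smaller element, and transitivity would link it to \<open>p\<close>. Any two elements are then
  linked through \<open>p\<close>.\<close>

lemma connected_matroid_if_smaller_neighbours:
  fixes M :: "'a::linorder set_system"
  assumes M: "matroid M"
    and smaller: "\<And>v. v \<in> ground M \<Longrightarrow> v \<noteq> p \<Longrightarrow> \<exists>w<v. \<exists>C. circuit M C \<and> v \<in> C \<and> w \<in> C"
  shows "connected_matroid M"
proof -
  have to_p: "\<exists>C. circuit M C \<and> v \<in> C \<and> p \<in> C" if "v \<in> ground M" "v \<noteq> p" for v
  proof (rule ccontr)
    assume none: "\<not> ?thesis"
    define S where "S = {v \<in> ground M. v \<noteq> p \<and> \<not> (\<exists>C. circuit M C \<and> v \<in> C \<and> p \<in> C)}"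
    have fin: "finite S" using matroid_finite_ground[OF M] by (simp add: S_def)
    have "S \<noteq> {}" using that none by (auto simp: S_def)
    then have u: "Min S \<in> S" using Min_in fin by blast
    then obtain w C where w: "w < Min S" "circuit M C" "Min S \<in> C" "w \<in> C"
      using smaller[of "Min S"] by (auto simp: S_def)
    then have "w \<notin> S" using Min_le[OF fin, of w] by auto
    moreover have "w \<in> ground M" using w circuit_subset_ground by blast
    moreover have "w \<noteq> p" using u w by (auto simp: S_def)
    ultimately obtain C' where C': "circuit M C'" "w \<in> C'" "p \<in> C'" by (auto simp: S_def)
    then have "\<exists>C. circuit M C \<and> Min S \<in> C \<and> p \<in> C"
      using circuit_through_two[OF M w(2) C'(1) _ w(3) C'(3)] w(4) by blast
    then show False using u by (auto simp: S_def)
  qed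
  have "\<exists>C. circuit M C \<and> e \<in> C \<and> f \<in> C" if ef: "e \<in> ground M" "f \<in> ground M" "e \<noteq> f" for e f
  proof (cases "e = p \<or> f = p")
    case True
    then show ?thesis using to_p[of e] to_p[of f] ef by blast
  next
    case False
    then obtain C C' where C: "circuit M C" "e \<in> C" "p \<in> C" and C': "circuit M C'" "f \<in> C'" "p \<in> C'"
      using to_p[of e] to_p[of f] ef by blast
    then show ?thesis using circuit_through_two[OF M C(1) C'(1) _ C(2) C'(2)] by blast
  qed
  then show ?thesis unfolding connected_matroid_def by blast
qed

text \<open>Adjacency is stated by basis exchange rather than by membership in a circuit: the
  condition is common to fundamental circuits and cocircuits and can be compared directly with
  independence in a minor.\<close>

definition fund_adj :: "'a set_system \<Rightarrow> 'a set \<Rightarrow> 'a \<Rightarrow> 'a \<Rightarrow> bool" where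
  "fund_adj M B v w \<longleftrightarrow>
     v \<in> B \<and> w \<in> ground M - B \<and> indep M (insert w (B - {v})) \<or>
     w \<in> B \<and> v \<in> ground M - B \<and> indep M (insert v (B - {w}))"

locale matroid_basis =
  fixes M :: "'a::linorder set_system" and B :: "'a set"
  assumes matroid: "matroid M" and basis: "basis M B"
begin

lemma basis_subset: "B \<subseteq> ground M"
  using indep_subset_ground[OF matroid basis_indep[OF basis]] .

lemma fundamental_graph_fund_adj: "fundamental_graph B (ground M - B) (fund_adj M B)"
  using matroid_finite_ground[OF matroid] finite_subset[OF basis_subset]
  by unfold_locales (auto simp: fund_adj_def)

sublocale internal: fundamental_graph B "ground M - B" "fund_adj M B"
  by (fact fundamental_graph_fund_adj)

sublocale external: fundamental_graph "ground M - B" B "fund_adj M B"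
  using internal.finite_P internal.finite_Q internal.disjoint internal.adj_sym internal.adj_bipartite
  by unfold_locales blast+

lemma ground_eq: "B \<union> (ground M - B) = ground M" "ground M - B \<union> B = ground M"
  using basis_subset by auto

lemma fund_circuit_fund_adj:
  "e \<in> ground M - B \<Longrightarrow> fund_circuit M B e = insert e {w. fund_adj M B e w}"
  using fund_circuit_eq[OF matroid basis] by (auto simp: fund_adj_def)

lemma fund_cocircuit_fund_adj:
  "b \<in> B \<Longrightarrow> fund_cocircuit M B b = insert b {w. fund_adj M B b w}"
  using fund_cocircuit_eq[OF matroid basis] by (auto simp: fund_adj_def)

lemma fund_adj_common_circuit:
  assumes "fund_adj M B v w"
  shows "\<exists>C. circuit M C \<and> v \<in> C \<and> w \<in> C"
proof -
  have *: "\<exists>C. circuit M C \<and> e \<in> C \<and> b \<in> C" if "e \<in> ground M - B" "fund_adj M B e b" for e b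
  proof -
    have "circuit M (insert e {b \<in> B. indep M (insert e (B - {b}))})"
      using circuit_in_insert_basis_iff[OF matroid basis that(1)] by blast
    then show ?thesis using that by (intro exI) (auto simp: fund_adj_def)
  qed
  show ?thesis
  proof (cases "v \<in> B")
    case True
    then have "w \<in> ground M - B" "fund_adj M B w v"
      using assms internal.adj_sym by (auto simp: fund_adj_def)
    then show ?thesis using * by blast
  next
    case False
    then show ?thesis using * assms by (auto simp: fund_adj_def)
  qed
qed

lemma eq_Min_insert_neighbours_iff:
  "v = Min (insert v {w. fund_adj M B v w}) \<longleftrightarrow> (\<forall>w. fund_adj M B v w \<longrightarrow> v < w)"
proof -
  have fin: "finite {w. fund_adj M B v w}"
    using finite_subset[of "{w. fund_adj M B v w}" "ground M"] matroid_finite_ground[OF matroid]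
      basis_subset by (auto simp: fund_adj_def)
  show ?thesis
  proof
    assume eq: "v = Min (insert v {w. fund_adj M B v w})"
    show "\<forall>w. fund_adj M B v w \<longrightarrow> v < w"
    proof (intro allI impI)
      fix w assume w: "fund_adj M B v w"
      then have "Min (insert v {w. fund_adj M B v w}) \<le> w" using fin by (intro Min_le) auto
      then show "v < w" using eq internal.adj_neq[OF w] by simp
    qed
  next
    assume "\<forall>w. fund_adj M B v w \<longrightarrow> v < w"
    then have "Min (insert v {w. fund_adj M B v w}) = v" using fin by (intro Min_eqI) auto
    then show "v = Min (insert v {w. fund_adj M B v w})" by simp
  qed
qed

lemma int_active_eq: "int_active M B = internal.active"
  by (auto simp: int_active_def internal.active_def fund_cocircuit_fund_adj
      eq_Min_insert_neighbours_iff simp del: Min_insert)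

lemma ext_active_eq: "ext_active M B = external.active"
  by (auto simp: ext_active_def external.active_def fund_circuit_fund_adj
      eq_Min_insert_neighbours_iff simp del: Min_insert)

lemma smaller_neighbours_eq:
  "v \<in> B \<Longrightarrow> {e \<in> fund_cocircuit M B v. e < v} = {w. fund_adj M B v w \<and> w < v}"
  "v \<in> ground M - B \<Longrightarrow> {b \<in> fund_circuit M B v. b < v} = {w. fund_adj M B v w \<and> w < v}"
  by (auto simp: fund_cocircuit_fund_adj fund_circuit_fund_adj)

lemma acl_int_eq:
  assumes "X \<subseteq> ground M"
  shows "acl_int M B X = internal.acl X"
proof -
  have "(\<forall>b\<in>B \<inter> A. fund_cocircuit M B b \<subseteq> A) \<longleftrightarrow> (\<forall>v\<in>B \<inter> A. \<forall>w. fund_adj M B v w \<longrightarrow> w \<in> A)" for A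
    by (intro ball_cong refl) (auto simp: fund_cocircuit_fund_adj)
  moreover have "(\<forall>b\<in>B. {e \<in> fund_cocircuit M B b. e < b} \<noteq> {} \<longrightarrow>
             {e \<in> fund_cocircuit M B b. e < b} \<subseteq> A \<longrightarrow> b \<in> A) \<longleftrightarrow>
      (\<forall>v\<in>B. (\<exists>w. fund_adj M B v w \<and> w < v) \<longrightarrow>
             (\<forall>w. fund_adj M B v w \<longrightarrow> w < v \<longrightarrow> w \<in> A) \<longrightarrow> v \<in> A)" for A
    by (intro ball_cong refl) (simp only: smaller_neighbours_eq, blast)
  ultimately have "acl_int M B X = (LEAST A. internal.acl_closed X A)"
    by (simp only: acl_int_def internal.acl_closed_def internal.P_closed_def ground_eq
        conj_assoc conj_left_commute)
  then show ?thesis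
    using internal.Least_acl_closed[of X] assms ground_eq by simp
qed

lemma acl_ext_eq:
  assumes "X \<subseteq> ground M"
  shows "acl_ext M B X = external.acl X"
proof -
  have "(\<forall>e\<in>(ground M - B) \<inter> A. fund_circuit M B e \<subseteq> A) \<longleftrightarrow>
      (\<forall>v\<in>(ground M - B) \<inter> A. \<forall>w. fund_adj M B v w \<longrightarrow> w \<in> A)" for A
    by (intro ball_cong refl) (auto simp: fund_circuit_fund_adj)
  moreover have "(\<forall>e\<in>ground M - B. {b \<in> fund_circuit M B e. b < e} \<noteq> {} \<longrightarrow>
             {b \<in> fund_circuit M B e. b < e} \<subseteq> A \<longrightarrow> e \<in> A) \<longleftrightarrow>
      (\<forall>v\<in>ground M - B. (\<exists>w. fund_adj M B v w \<and> w < v) \<longrightarrow>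
             (\<forall>w. fund_adj M B v w \<longrightarrow> w < v \<longrightarrow> w \<in> A) \<longrightarrow> v \<in> A)" for A
    by (intro ball_cong refl) (simp only: smaller_neighbours_eq, blast)
  ultimately have "acl_ext M B X = (LEAST A. external.acl_closed X A)"
    by (simp only: acl_ext_def external.acl_closed_def external.P_closed_def ground_eq
        conj_assoc conj_left_commute)
  then show ?thesis
    using external.Least_acl_closed[of X] assms ground_eq by simp
qed

lemma connected_if_unique_active:
  assumes "internal.active \<union> external.active \<subseteq> {p}"
  shows "connected_matroid M"
proof (rule connected_matroid_if_smaller_neighbours[OF matroid])
  fix v assume v: "v \<in> ground M" "v \<noteq> p"
  then have "v \<in> B \<and> v \<notin> internal.active \<or> v \<in> ground M - B \<and> v \<notin> external.active"
    using assms by blast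
  then obtain w where "fund_adj M B v w" "w < v"
    using internal.not_active_smaller external.not_active_smaller by blast
  then show "\<exists>w<v. \<exists>C. circuit M C \<and> v \<in> C \<and> w \<in> C"
    using fund_adj_common_circuit by blast
qed

text \<open>\<open>B \<inter> F\<close> is always independent; it is maximal in \<open>F\<close> iff
  the fundamental circuit of every element of \<open>F - B\<close> stays in \<open>F\<close>. A
  circuit element \<open>w\<close> outside \<open>F\<close> would leave
  \<open>insert v (B \<inter> F)\<close> inside the independent set
  \<open>insert v (B - {w})\<close>.\<close>

lemma spanning_iff_external_closed:
  "F \<subseteq> ground M \<Longrightarrow> basis (restriction M F) (B \<inter> F) \<longleftrightarrow> external.P_closed F"
proof
  assume F: "F \<subseteq> ground M" and span: "basis (restriction M F) (B \<inter> F)"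
  have "w \<in> F" if v: "v \<in> ground M - B" "v \<in> F" and w: "fund_adj M B v w" for v w
  proof (rule ccontr)
    assume "w \<notin> F"
    moreover have "indep M (insert v (B - {w}))" using v w by (auto simp: fund_adj_def)
    ultimately have "indep M (insert v (B \<inter> F))"
      using indep_mono[OF matroid, of "insert v (B - {w})" "insert v (B \<inter> F)"] by blast
    then show False using basis_maximal[OF span, of v] v by auto
  qed
  then show "external.P_closed F" using F by (auto simp: external.P_closed_def)
next
  assume F: "F \<subseteq> ground M" and closed: "external.P_closed F"
  show "basis (restriction M F) (B \<inter> F)"
  proof (rule basisI[OF matroid_restriction[OF matroid F]])
    show "indep (restriction M F) (B \<inter> F)"
      using indep_mono[OF matroid basis_indep[OF basis]] by auto
    fix e assume "e \<in> ground (restriction M F) - B \<inter> F"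
    then have e: "e \<in> ground M - B" "e \<in> F" using F by auto
    let ?C = "insert e {b \<in> B. indep M (insert e (B - {b}))}"
    have "?C \<subseteq> insert e (B \<inter> F)"
      using closed e by (auto simp: external.P_closed_def fund_adj_def)
    moreover have "circuit M ?C"
      using circuit_in_insert_basis_iff[OF matroid basis e(1)] by blast
    ultimately have "\<not> indep M (insert e (B \<inter> F))"
      using circuit_dependent indep_mono[OF matroid] by blast
    then show "\<not> indep (restriction M F) (insert e (B \<inter> F))" by simp
  qed
qed

text \<open>Both conditions forbid the same edges, those between \<open>F - B\<close> and
  \<open>B - F\<close>.\<close>

lemma internal_closed_complement_iff:
  assumes "F \<subseteq> ground M"
  shows "internal.P_closed (ground M - F) \<longleftrightarrow> external.P_closed F"
proof
  assume i: "internal.P_closed (ground M - F)"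
  have "w \<in> F" if v: "v \<in> ground M - B" "v \<in> F" and w: "fund_adj M B v w" for v w
  proof (rule ccontr)
    assume "w \<notin> F"
    moreover have "w \<in> B" using v w by (auto simp: fund_adj_def)
    ultimately have "v \<in> ground M - F"
      using internal.P_closed_neighbour[OF i _ _ internal.adj_sym[OF w]] basis_subset by blast
    then show False using v by blast
  qed
  then show "external.P_closed F" using assms by (auto simp: external.P_closed_def)
next
  assume e: "external.P_closed F"
  have "w \<in> ground M - F" if v: "v \<in> B" "v \<in> ground M - F" and w: "fund_adj M B v w" for v w
  proof -
    have "w \<in> ground M - B" using v w by (auto simp: fund_adj_def)
    then show ?thesis
      using e v internal.adj_sym[OF w] by (auto simp: external.P_closed_def)
  qed
  then show "internal.P_closed (ground M - F)" by (auto simp: internal.P_closed_def)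
qed

text \<open>\<open>B \<inter> A\<close> serves as the contracted basis, which reduces the claim to
  \<open>B \<inter> G\<close>. The fundamental circuit of \<open>e\<close> stays in
  \<open>insert e (B \<inter> G)\<close>, so removing \<open>b\<close> restores independence there
  exactly when \<open>b\<close> is on that circuit.\<close>

lemma indep_minor_exchange_iff:
  assumes AG: "A \<subseteq> G" "G \<subseteq> ground M" and closed: "external.P_closed A" "external.P_closed G"
    and b: "b \<in> B \<inter> (G - A)" and e: "e \<in> G - A - B"
  shows "indep (minor M G A) (insert e (B \<inter> (G - A) - {b})) \<longleftrightarrow> indep M (insert e (B - {b}))"
proof -
  have A: "basis (restriction M A) (B \<inter> A)"
    using closed AG spanning_iff_external_closed[of A] by auto
  have "insert e (B \<inter> (G - A) - {b}) \<union> B \<inter> A = insert e (B \<inter> G - {b})"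
    using AG b by blast
  then have iff: "indep (minor M G A) (insert e (B \<inter> (G - A) - {b})) \<longleftrightarrow> indep M (insert e (B \<inter> G - {b}))"
    using indep_minor_iff[OF matroid AG A] e by auto
  have e': "e \<in> ground M - B" using e AG by blast
  let ?C = "insert e {b \<in> B. indep M (insert e (B - {b}))}"
  have C: "circuit M ?C" using circuit_in_insert_basis_iff[OF matroid basis e'] by blast
  have "?C \<subseteq> insert e (B \<inter> G)"
    using closed(2) e e' by (auto simp: external.P_closed_def fund_adj_def)
  then have "indep M (insert e (B - {b}))" if "indep M (insert e (B \<inter> G - {b}))"
    using circuit_dependent[OF C] indep_mono[OF matroid that, of ?C] b by blast
  moreover have "indep M (insert e (B \<inter> G - {b}))" if "indep M (insert e (B - {b}))"
    using indep_mono[OF matroid that, of "insert e (B \<inter> G - {b})"] by blast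
  ultimately show ?thesis using iff by blast
qed

lemma active_minor:
  assumes AG: "A \<subseteq> G" "G \<subseteq> ground M" and closed: "external.P_closed A" "external.P_closed G"
  shows "matroid_basis (minor M G A) (B \<inter> (G - A))"
    and "int_active (minor M G A) (B \<inter> (G - A)) = internal.local_min B (G - A)"
    and "ext_active (minor M G A) (B \<inter> (G - A)) = internal.local_min (ground M - B) (G - A)"
proof -
  have span: "basis (restriction M A) (B \<inter> A)" "basis (restriction M G) (B \<inter> G)"
    using closed AG spanning_iff_external_closed[of A] spanning_iff_external_closed[of G] by auto
  show "matroid_basis (minor M G A) (B \<inter> (G - A))"
    using matroid_minor[OF matroid AG] basis_restriction_minor_iff[OF matroid AG span(1)] span(2)
    by (intro matroid_basis.intro) auto
  then interpret minor: matroid_basis "minor M G A" "B \<inter> (G - A)" .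
  have adj: "fund_adj (minor M G A) (B \<inter> (G - A)) v w \<longleftrightarrow> v \<in> G - A \<and> w \<in> G - A \<and> fund_adj M B v w"
    for v w
  proof -
    have g: "x \<in> G - A - B \<and> x \<in> ground M" if "x \<in> G - A - B \<inter> (G - A)" for x
      using that AG by blast
    show ?thesis
      unfolding fund_adj_def ground_minor
      using indep_minor_exchange_iff[OF AG closed, of v w] indep_minor_exchange_iff[OF AG closed, of w v]
        g[of v] g[of w] by blast
  qed
  show "int_active (minor M G A) (B \<inter> (G - A)) = internal.local_min B (G - A)"
    unfolding minor.int_active_eq minor.internal.active_def internal.local_min_def adj by auto
  show "ext_active (minor M G A) (B \<inter> (G - A)) = internal.local_min (ground M - B) (G - A)"
    unfolding minor.ext_active_eq minor.external.active_def internal.local_min_def adj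
    using AG by auto
qed

lemma uniactive_minor_iff:
  assumes "A \<subseteq> G" "G \<subseteq> ground M" "external.P_closed A" "external.P_closed G"
  shows "uniactive_internal (minor M G A) (B \<inter> (G - A)) \<longleftrightarrow>
      card (internal.local_min B (G - A)) = 1 \<and> internal.local_min (ground M - B) (G - A) = {}"
    and "uniactive_external (minor M G A) (B \<inter> (G - A)) \<longleftrightarrow>
      card (internal.local_min (ground M - B) (G - A)) = 1 \<and> internal.local_min B (G - A) = {}"
  using active_minor[OF assms]
  by (auto simp: uniactive_internal_def uniactive_external_def matroid_basis_def)

end

section \<open>Uniactive bases force connectedness\<close>

lemma uniactive_internalD:
  assumes "matroid M" "uniactive_internal M B"
  shows "connected_matroid M" "\<not> is_loop M" "is_isthmus M \<Longrightarrow> B = ground M"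
proof -
  have "basis M B" using assms(2) by (simp add: uniactive_internal_def)
  then interpret matroid_basis M B using assms(1) by unfold_locales
  obtain p where p: "int_active M B = {p}" "ext_active M B = {}"
    using assms(2) by (auto simp: uniactive_internal_def card_1_singleton_iff)
  then show "connected_matroid M"
    using connected_if_unique_active[of p] by (simp add: int_active_eq ext_active_eq)
  \<comment> \<open>The active element lies in \<open>B\<close>, so a one-element ground set equals
    \<open>B\<close> and its element cannot be a loop.\<close>
  have pB: "p \<in> B" using p by (auto simp: int_active_def)
  show "is_isthmus M \<Longrightarrow> B = ground M"
    using pB basis_subset by (auto simp: is_isthmus_def)
  show "\<not> is_loop M"
  proof
    assume "is_loop M"
    then obtain e where e: "ground M = {e}" "circuit M {e}" by (auto simp: is_loop_def loop_def)
    then have "B = {e}" using pB basis_subset by auto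
    then show False using circuit_dependent[OF e(2)] basis_indep[OF basis] by simp
  qed
qed

lemma uniactive_externalD:
  assumes "matroid M" "uniactive_external M B"
  shows "connected_matroid M" "\<not> is_isthmus M" "is_loop M \<Longrightarrow> B = {}"
proof -
  have "basis M B" using assms(2) by (simp add: uniactive_external_def)
  then interpret matroid_basis M B using assms(1) by unfold_locales
  obtain p where p: "ext_active M B = {p}" "int_active M B = {}"
    using assms(2) by (auto simp: uniactive_external_def card_1_singleton_iff)
  then show "connected_matroid M"
    using connected_if_unique_active[of p] by (simp add: int_active_eq ext_active_eq)
  \<comment> \<open>Here a one-element ground set is disjoint from \<open>B\<close>, so
    \<open>B\<close> is empty and witnesses that the element is independent in the dual, hence no
    coloop.\<close>
  have pB: "p \<in> ground M - B" using p by (auto simp: ext_active_def)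
  show "is_loop M \<Longrightarrow> B = {}"
    using pB basis_subset by (auto simp: is_loop_def)
  show "\<not> is_isthmus M"
  proof
    assume "is_isthmus M"
    then obtain e where e: "ground M = {e}" "circuit (dual M) {e}"
      by (auto simp: is_isthmus_def coloop_def cocircuit_def)
    then have "{e} \<inter> B = {}" using pB by auto
    then have "indep (dual M) {e}" using e(1) basis by (auto simp: dual_def)
    then show False using circuit_dependent[OF e(2)] by simp
  qed
qed

text \<open>Filtrations number their pieces from 1, between \<open>k - 1\<close> and
  \<open>k\<close>; chains number them from 0, between \<open>k\<close> and
  \<open>Suc k\<close>.\<close>

lemma ball_pred_shift:
  fixes n :: nat
  shows "(\<forall>k\<in>{1..n}. R (k - 1) k) \<longleftrightarrow> (\<forall>k. k < n \<longrightarrow> R k (Suc k))"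
proof
  assume *: "\<forall>k\<in>{1..n}. R (k - 1) k"
  show "\<forall>k. k < n \<longrightarrow> R k (Suc k)"
  proof (intro allI impI)
    fix k assume "k < n"
    then show "R k (Suc k)" using *[rule_format, of "Suc k"] by simp
  qed
next
  assume *: "\<forall>k. k < n \<longrightarrow> R k (Suc k)"
  show "\<forall>k\<in>{1..n}. R (k - 1) k"
  proof
    fix k assume "k \<in> {1..n}"
    then show "R (k - 1) k" using * by (cases k) auto
  qed
qed

lemma strict_mono_on_pred_shift:
  fixes n :: nat and f :: "nat \<Rightarrow> nat \<Rightarrow> 'a::linorder"
  shows "strict_mono_on {1..n} (\<lambda>k. f (k - 1) k) \<longleftrightarrow>
    (\<forall>i j. i < j \<longrightarrow> j < n \<longrightarrow> f i (Suc i) < f j (Suc j))"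
proof
  assume *: "strict_mono_on {1..n} (\<lambda>k. f (k - 1) k)"
  show "\<forall>i j. i < j \<longrightarrow> j < n \<longrightarrow> f i (Suc i) < f j (Suc j)"
  proof (intro allI impI)
    fix i j assume "i < j" "j < n"
    then show "f i (Suc i) < f j (Suc j)"
      using strict_mono_onD[OF *, of "Suc i" "Suc j"] by simp
  qed
next
  assume *: "\<forall>i j. i < j \<longrightarrow> j < n \<longrightarrow> f i (Suc i) < f j (Suc j)"
  show "strict_mono_on {1..n} (\<lambda>k. f (k - 1) k)"
  proof (rule strict_mono_onI)
    fix r s assume "r \<in> {1..n}" "s \<in> {1..n}" "r < s"
    then show "f (r - 1) r < f (s - 1) s"
      using *[rule_format, of "r - 1" "s - 1"] by auto
  qed
qed

section \<open>Filtrations and chains of closed sets\<close>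

context matroid_basis
begin

text \<open>Complementing reverses the list but leaves every piece unchanged, and for spanned sets
  uniactivity of a minor is a count of local minima in its piece.\<close>

lemma internal_chain_iff:
  assumes ne: "F \<noteq> []" and last: "last F = ground M"
    and sub: "\<And>A. A \<in> set F \<Longrightarrow> A \<subseteq> ground M" and closed: "\<And>A. A \<in> set F \<Longrightarrow> external.P_closed A"
  shows "internal.uniactive_chain (map ((-) (ground M)) F) \<longleftrightarrow>
     (\<forall>k\<in>{1..length F - 1}. F ! (k - 1) \<subset> F ! k) \<and>
     (\<forall>k\<in>{1..length F - 1}.
        uniactive_internal (minor M (F ! k) (F ! (k - 1))) (B \<inter> (F ! k - F ! (k - 1)))) \<and>
     strict_mono_on {1..length F - 1} (\<lambda>k. Min (F ! k - F ! (k - 1)))"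
proof -
  define D where "D = map ((-) (ground M)) F"
  define n where "n = length F - 1"
  have len: "length F = Suc n" "length D = Suc n" using ne by (simp_all add: n_def D_def)
  have nth: "F ! k \<subseteq> ground M" "external.P_closed (F ! k)" if "k \<le> n" for k
    using that len sub closed by auto
  have D: "D ! k = ground M - F ! k" if "k \<le> n" for k using that len by (simp add: D_def)
  have diff: "D ! k - D ! Suc k = F ! Suc k - F ! k" if "k < n" for k
    using that D[of k] D[of "Suc k"] nth[of "Suc k"] by auto
  have D': "D \<noteq> []" "last D = {}" "\<forall>A\<in>set D. internal.P_closed A"
    using ne last sub closed internal_closed_complement_iff by (auto simp: D_def last_map)
  have step: "D ! Suc k \<subset> D ! k \<and> card (internal.local_min B (D ! k - D ! Suc k)) = 1 \<and>
      internal.local_min (ground M - B) (D ! k - D ! Suc k) = {} \<longleftrightarrow>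
      F ! k \<subset> F ! Suc k \<and>
      uniactive_internal (minor M (F ! Suc k) (F ! k)) (B \<inter> (F ! Suc k - F ! k))" if k: "k < n" for k
  proof -
    have "D ! Suc k \<subset> D ! k \<longleftrightarrow> F ! k \<subset> F ! Suc k"
      using k D[of k] D[of "Suc k"] nth(1)[of k] nth(1)[of "Suc k"] by auto
    then show ?thesis
      using uniactive_minor_iff(1)[of "F ! k" "F ! Suc k"] nth[of k] nth[of "Suc k"] k
      unfolding diff[OF k] by auto
  qed
  have mono: "(i < j \<longrightarrow> j < n \<longrightarrow> Min (D ! i - D ! Suc i) < Min (D ! j - D ! Suc j)) \<longleftrightarrow>
      (i < j \<longrightarrow> j < n \<longrightarrow> Min (F ! Suc i - F ! i) < Min (F ! Suc j - F ! j))" for i j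
    using diff[of i] diff[of j] by auto
  have "internal.uniactive_chain D \<longleftrightarrow>
      (\<forall>k. k < n \<longrightarrow> D ! Suc k \<subset> D ! k \<and> card (internal.local_min B (D ! k - D ! Suc k)) = 1 \<and>
        internal.local_min (ground M - B) (D ! k - D ! Suc k) = {}) \<and>
      (\<forall>i j. i < j \<longrightarrow> j < n \<longrightarrow> Min (D ! i - D ! Suc i) < Min (D ! j - D ! Suc j))"
    unfolding internal.uniactive_chain_def len Suc_less_eq using D' by simp
  also have "\<dots> \<longleftrightarrow>
      (\<forall>k. k < n \<longrightarrow> F ! k \<subset> F ! Suc k \<and>
        uniactive_internal (minor M (F ! Suc k) (F ! k)) (B \<inter> (F ! Suc k - F ! k))) \<and>
      (\<forall>i j. i < j \<longrightarrow> j < n \<longrightarrow> Min (F ! Suc i - F ! i) < Min (F ! Suc j - F ! j))"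
    unfolding mono by (intro conj_cong refl all_cong1 imp_cong step)
  finally show ?thesis
    unfolding D_def[symmetric] n_def[symmetric]
      ball_pred_shift[where R = "\<lambda>i j. F ! i \<subset> F ! j"]
      ball_pred_shift[where R = "\<lambda>i j. uniactive_internal (minor M (F ! j) (F ! i)) (B \<inter> (F ! j - F ! i))"]
      strict_mono_on_pred_shift[where f = "\<lambda>i j. Min (F ! j - F ! i)"]
    by blast
qed

lemma external_chain_iff:
  assumes ne: "F \<noteq> []" and last: "last F = {}"
    and sub: "\<And>A. A \<in> set F \<Longrightarrow> A \<subseteq> ground M" and closed: "\<And>A. A \<in> set F \<Longrightarrow> external.P_closed A"
  shows "external.uniactive_chain F \<longleftrightarrow>
     (\<forall>k\<in>{1..length F - 1}. F ! k \<subset> F ! (k - 1)) \<and>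
     (\<forall>k\<in>{1..length F - 1}.
        uniactive_external (minor M (F ! (k - 1)) (F ! k)) (B \<inter> (F ! (k - 1) - F ! k))) \<and>
     strict_mono_on {1..length F - 1} (\<lambda>k. Min (F ! (k - 1) - F ! k))"
proof -
  define n where "n = length F - 1"
  have len: "length F = Suc n" using ne by (simp add: n_def)
  have nth: "F ! k \<subseteq> ground M" "external.P_closed (F ! k)" if "k \<le> n" for k
    using that len sub closed by auto
  have step: "F ! Suc k \<subset> F ! k \<and> card (internal.local_min (ground M - B) (F ! k - F ! Suc k)) = 1 \<and>
      internal.local_min B (F ! k - F ! Suc k) = {} \<longleftrightarrow>
      F ! Suc k \<subset> F ! k \<and>
      uniactive_external (minor M (F ! k) (F ! Suc k)) (B \<inter> (F ! k - F ! Suc k))" if k: "k < n" for k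
    using uniactive_minor_iff(2)[of "F ! Suc k" "F ! k"] nth[of k] nth[of "Suc k"] k by auto
  have "external.uniactive_chain F \<longleftrightarrow>
      (\<forall>k. k < n \<longrightarrow> F ! Suc k \<subset> F ! k \<and>
        card (internal.local_min (ground M - B) (F ! k - F ! Suc k)) = 1 \<and>
        internal.local_min B (F ! k - F ! Suc k) = {}) \<and>
      (\<forall>i j. i < j \<longrightarrow> j < n \<longrightarrow> Min (F ! i - F ! Suc i) < Min (F ! j - F ! Suc j))"
    unfolding external.uniactive_chain_def len Suc_less_eq using ne last closed by simp
  also have "\<dots> \<longleftrightarrow>
      (\<forall>k. k < n \<longrightarrow> F ! Suc k \<subset> F ! k \<and>
        uniactive_external (minor M (F ! k) (F ! Suc k)) (B \<inter> (F ! k - F ! Suc k))) \<and>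
      (\<forall>i j. i < j \<longrightarrow> j < n \<longrightarrow> Min (F ! i - F ! Suc i) < Min (F ! j - F ! Suc j))"
    by (intro conj_cong refl all_cong1 imp_cong step)
  finally show ?thesis
    unfolding n_def[symmetric]
      ball_pred_shift[where R = "\<lambda>i j. F ! j \<subset> F ! i"]
      ball_pred_shift[where R = "\<lambda>i j. uniactive_external (minor M (F ! i) (F ! j)) (B \<inter> (F ! i - F ! j))"]
      strict_mono_on_pred_shift[where f = "\<lambda>i j. Min (F ! i - F ! j)"]
    by blast
qed

lemma external_closed_minor_step:
  assumes "A \<subseteq> G" "G \<subseteq> ground M" "external.P_closed A" "basis (minor M G A) (B \<inter> (G - A))"
  shows "external.P_closed G"
  using assms basis_restriction_minor_iff[OF matroid assms(1,2)]
    spanning_iff_external_closed[of A] spanning_iff_external_closed[of G] by auto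

text \<open>As \<open>acl {}\<close> is empty, the final sets that the definition appends separately
  are the entries at index \<open>length a'\<close> and \<open>length a\<close> of uniform lists of
  closures.\<close>

lemma active_filtration_eq:
  defines "a \<equiv> sorted_list_of_set internal.active" and "a' \<equiv> sorted_list_of_set external.active"
  shows "active_filtration M B =
     (map (\<lambda>k. external.acl (set (drop k a'))) [0..<Suc (length a')],
      external.acl external.active,
      map ((-) (ground M)) (map (\<lambda>k. internal.acl (set (drop k a))) [0..<Suc (length a)]))"
proof -
  have "set a = internal.active" "set a' = external.active"
    using internal.finite_active external.finite_active by (auto simp: a_def a'_def)
  then have "set (drop k a) \<subseteq> ground M" "set (drop k a') \<subseteq> ground M" "external.active \<subseteq> ground M" for k
    using set_drop_subset[of k a] set_drop_subset[of k a'] internal.active_subset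
      external.active_subset basis_subset by auto
  then show ?thesis
    unfolding active_filtration_def int_active_eq ext_active_eq a_def[symmetric] a'_def[symmetric] Let_def
    by (simp add: acl_int_eq acl_ext_eq)
qed

lemma decomposition_unique:
  assumes filt: "filtration (ground M) (F', Fc, F)" and dec: "uniactive_decomposition M B (F', Fc, F)"
  shows "(F', Fc, F) = active_filtration M B"
proof -
  define n n' where "n = length F - 1" and "n' = length F' - 1"
  have ne: "F \<noteq> []" "F' \<noteq> []" using filt by auto
  then have len: "length F = Suc n" "length F' = Suc n'" by (simp_all add: n_def n'_def)
  have ends: "F' ! n' = {}" "F' ! 0 = F ! 0" "F ! n = ground M" "Fc = F' ! 0"
    using filt ne len by (auto simp: last_conv_nth)
  have inc: "F ! k \<subset> F ! Suc k"
    and int: "uniactive_internal (minor M (F ! Suc k) (F ! k)) (B \<inter> (F ! Suc k - F ! k))"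
    if "k < n" for k
    using filt dec that len
      ball_pred_shift[where R = "\<lambda>i j. F ! i \<subset> F ! j" and n = n]
      ball_pred_shift[where n = n and
        R = "\<lambda>i j. uniactive_internal (minor M (F ! j) (F ! i)) (B \<inter> (F ! j - F ! i))"]
    by auto
  have dec': "F' ! Suc k \<subset> F' ! k"
    and ext: "uniactive_external (minor M (F' ! k) (F' ! Suc k)) (B \<inter> (F' ! k - F' ! Suc k))"
    if "k < n'" for k
    using filt dec that len
      ball_pred_shift[where R = "\<lambda>i j. F' ! j \<subset> F' ! i" and n = n']
      ball_pred_shift[where n = n' and
        R = "\<lambda>i j. uniactive_external (minor M (F' ! i) (F' ! j)) (B \<inter> (F' ! i - F' ! j))"]
    by auto
  have sub: "F ! k \<subseteq> ground M" if "k \<le> n" for k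
    using that
  proof (induction k rule: inc_induct)
    case base
    then show ?case using ends by simp
  next
    case (step k)
    then show ?case using inc[of k] by auto
  qed
  have sub': "F' ! k \<subseteq> ground M" if "k \<le> n'" for k
    using that
  proof (induction k)
    case 0
    then show ?case using ends sub[of 0] by simp
  next
    case (Suc k)
    then show ?case using dec'[of k] by auto
  qed
  \<comment> \<open>The climb starts at the empty set \<open>F' ! n'\<close> and reaches
    \<open>F' ! 0\<close>. As this is also \<open>F ! 0\<close>, it continues upwards through
    \<open>F\<close>.\<close>
  have closed': "external.P_closed (F' ! k)" if "k \<le> n'" for k
    using that
  proof (induction k rule: inc_induct)
    case base
    then show ?case using ends by (simp add: external.P_closed_def)
  next
    case (step k)
    then show ?case
      using external_closed_minor_step[of "F' ! Suc k" "F' ! k"] dec'[of k] ext[of k] sub'[of k]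
      by (auto simp: uniactive_external_def)
  qed
  have closed: "external.P_closed (F ! k)" if "k \<le> n" for k
    using that
  proof (induction k)
    case 0
    then show ?case using ends closed'[of 0] by simp
  next
    case (Suc k)
    then show ?case
      using external_closed_minor_step[of "F ! k" "F ! Suc k"] inc[of k] int[of k] sub[of "Suc k"]
      by (auto simp: uniactive_internal_def)
  qed
  have set_F: "A \<subseteq> ground M" "external.P_closed A" if A: "A \<in> set F" for A
  proof -
    obtain k where "k \<le> n" "A = F ! k"
      using A len by (auto simp: in_set_conv_nth less_Suc_eq_le)
    then show "A \<subseteq> ground M" "external.P_closed A" using sub closed by simp_all
  qed
  have set_F': "A \<subseteq> ground M" "external.P_closed A" if A: "A \<in> set F'" for A
  proof -
    obtain k where "k \<le> n'" "A = F' ! k"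
      using A len by (auto simp: in_set_conv_nth less_Suc_eq_le)
    then show "A \<subseteq> ground M" "external.P_closed A" using sub' closed' by simp_all
  qed
  have last: "last F = ground M" "last F' = {}" using filt by auto
  let ?D = "map ((-) (ground M)) F"
  have chain: "internal.uniactive_chain ?D"
    using internal_chain_iff[OF ne(1) last(1) set_F] filt dec by simp
  have chain': "external.uniactive_chain F'"
    using external_chain_iff[OF ne(2) last(2) set_F'] filt dec by simp
  have D0: "?D ! 0 = ground M - F' ! 0" using ends len by simp
  \<comment> \<open>Such a \<open>v\<close> lies in \<open>F' ! 0\<close>, hence in an external
    piece. That piece has no local minimum on side \<open>B\<close>, so \<open>v\<close> has a
    smaller neighbour within it, again in \<open>F' ! 0\<close>.\<close>
  have "\<exists>w. w \<notin> ?D ! 0 \<and> fund_adj M B v w \<and> w < v" if v: "v \<in> B" "v \<notin> ?D ! 0" for v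
  proof -
    have "v \<in> F' ! 0" using v D0 basis_subset by blast
    then obtain k where k: "k < n'" "v \<in> F' ! k - F' ! Suc k"
      using external.chain_piece[OF ne(2) last(2), of 0 v] len by auto
    moreover have "internal.local_min B (F' ! k - F' ! Suc k) = {}"
      using chain' k len by (auto simp: external.uniactive_chain_def)
    ultimately obtain w where w: "w \<in> F' ! k - F' ! Suc k" "fund_adj M B v w" "w < v"
      using internal.not_local_min_smaller[of v B] v by blast
    have "F' ! k \<subseteq> F' ! 0" using k(1)
    proof (induction k)
      case (Suc k)
      then show ?case using dec'[of k] by auto
    qed simp
    then show ?thesis using w D0 by blast
  qed
  then have D: "?D = map (\<lambda>k. internal.acl (set (drop k (sorted_list_of_set internal.active))))
      [0..<Suc (length (sorted_list_of_set internal.active))]"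
    using internal.uniactive_chain_unique[OF chain] by blast
  \<comment> \<open>Symmetrically, \<open>v\<close> lies in an internal piece, which has no local
    minimum outside \<open>B\<close>.\<close>
  have "\<exists>w. w \<notin> F' ! 0 \<and> fund_adj M B v w \<and> w < v" if v: "v \<in> ground M - B" "v \<notin> F' ! 0" for v
  proof -
    have "v \<in> ?D ! 0" using v D0 by blast
    then obtain k where k: "k < n" "v \<in> ?D ! k - ?D ! Suc k"
      using internal.chain_piece[of ?D 0 v] chain len by (auto simp: internal.uniactive_chain_def)
    moreover have "internal.local_min (ground M - B) (?D ! k - ?D ! Suc k) = {}"
      using chain k len by (auto simp: internal.uniactive_chain_def)
    ultimately obtain w where w: "w \<in> ?D ! k - ?D ! Suc k" "fund_adj M B v w" "w < v"
      using internal.not_local_min_smaller[of v "ground M - B"] v by blast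
    have "F ! 0 \<subseteq> F ! k" using k(1)
    proof (induction k)
      case (Suc k)
      then show ?case using inc[of k] by auto
    qed simp
    then show ?thesis using w ends k(1) len by (intro exI[of _ w]) auto
  qed
  then have F': "F' = map (\<lambda>k. external.acl (set (drop k (sorted_list_of_set external.active))))
      [0..<Suc (length (sorted_list_of_set external.active))]"
    using external.uniactive_chain_unique[OF chain'] by blast
  have "Fc = external.acl external.active"
    using ends(4) external.finite_active by (subst (asm) F') (simp add: nth_append del: upt_Suc)
  moreover have "F = map ((-) (ground M)) ?D"
    using set_F(1) by (simp add: map_idI double_diff)
  ultimately show ?thesis
    unfolding active_filtration_eq by (simp only: D[symmetric] F'[symmetric])
qed

text \<open>The chains of active closures consist of closed sets by construction, so the chain
  equivalences apply at once; what remains is that the two halves meet in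
  \<open>F_c\<close>.\<close>

lemma active_filtration_decomposition:
  "filtration (ground M) (active_filtration M B) \<and> uniactive_decomposition M B (active_filtration M B)"
proof -
  define a where "a = sorted_list_of_set internal.active"
  define a' where "a' = sorted_list_of_set external.active"
  define D where "D = map (\<lambda>k. internal.acl (set (drop k a))) [0..<Suc (length a)]"
  define F' where "F' = map (\<lambda>k. external.acl (set (drop k a'))) [0..<Suc (length a')]"
  define F where "F = map ((-) (ground M)) D"
  have af: "active_filtration M B = (F', external.acl external.active, F)"
    unfolding active_filtration_eq F_def D_def F'_def a_def a'_def ..
  have chain: "internal.uniactive_chain D"
    unfolding D_def a_def by (rule internal.uniactive_chain_acl)
  have chain': "external.uniactive_chain F'"
    unfolding F'_def a'_def by (rule external.uniactive_chain_acl)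
  have subD: "A \<subseteq> ground M" "internal.P_closed A" if "A \<in> set D" for A
    using internal.uniactive_chainD(3)[OF chain that] internal.P_closed_subset ground_eq by auto
  have D: "D = map ((-) (ground M)) F"
    using subD(1) by (simp add: F_def map_idI double_diff)
  have set_F: "A \<subseteq> ground M" "external.P_closed A" if A: "A \<in> set F" for A
  proof -
    obtain X where X: "X \<in> set D" "A = ground M - X" using A by (auto simp: F_def)
    then show "A \<subseteq> ground M" by blast
    moreover have "ground M - A = X" using X subD(1) by blast
    ultimately show "external.P_closed A"
      using internal_closed_complement_iff[of A] subD(2)[OF X(1)] by simp
  qed
  have set_F': "A \<subseteq> ground M" "external.P_closed A" if "A \<in> set F'" for A
    using external.uniactive_chainD(3)[OF chain' that] external.P_closed_subset ground_eq by auto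
  have ne: "F \<noteq> []" "F' \<noteq> []" by (simp_all add: F_def D_def F'_def)
  have last: "last F = ground M" "last F' = {}"
    using chain chain' ne by (auto simp: F_def last_map internal.uniactive_chain_def external.uniactive_chain_def)
  have "D ! 0 = internal.acl internal.active"
    using internal.finite_active by (simp add: D_def a_def nth_append del: upt_Suc)
  then have F0: "F ! 0 = ground M - internal.acl internal.active" by (simp add: F_def D_def del: upt_Suc)
  have F'0: "F' ! 0 = external.acl external.active"
    using external.finite_active by (simp add: F'_def a'_def nth_append del: upt_Suc)
  have "F ! 0 = F' ! 0"
    using internal.P_Un_Q_diff_acl_active unfolding F0 F'0 ground_eq .
  moreover note internal_chain_iff[OF ne(1) last(1) set_F, folded D]
    external_chain_iff[OF ne(2) last(2) set_F']
  ultimately show ?thesis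
    unfolding af using chain chain' ne last F'0 by simp
qed

lemma connected_decomposition:
  assumes filt: "filtration (ground M) (F', Fc, F)" and dec: "uniactive_decomposition M B (F', Fc, F)"
  shows "connected_filtration M (F', Fc, F)"
    and "\<forall>k\<in>{1..length F - 1}. is_isthmus (minor M (F ! k) (F ! (k - 1))) \<longrightarrow>
          B \<inter> (F ! k - F ! (k - 1)) = ground (minor M (F ! k) (F ! (k - 1)))"
    and "\<forall>k\<in>{1..length F' - 1}. is_loop (minor M (F' ! (k - 1)) (F' ! k)) \<longrightarrow>
          B \<inter> (F' ! (k - 1) - F' ! k) = {}"
proof -
  have inc: "F ! (k - 1) \<subset> F ! k" if "k \<in> {1..length F - 1}" for k using filt that by simp
  have dec': "F' ! k \<subset> F' ! (k - 1)" if "k \<in> {1..length F' - 1}" for k using filt that by simp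
  have sub: "F ! k \<subseteq> ground M" if "k \<le> length F - 1" for k
    using that
  proof (induction k rule: inc_induct)
    case base
    then show ?case using filt by (metis filtration.simps last_conv_nth order_refl)
  next
    case (step k)
    then show ?case using inc[of "Suc k"] by auto
  qed
  have sub': "F' ! k \<subseteq> ground M" if "k \<le> length F' - 1" for k
    using that
  proof (induction k)
    case 0
    then show ?case using filt sub[of 0] by simp
  next
    case (Suc k)
    then show ?case using dec'[of "Suc k"] by auto
  qed
  have int: "matroid (minor M (F ! k) (F ! (k - 1)))"
    "uniactive_internal (minor M (F ! k) (F ! (k - 1))) (B \<inter> (F ! k - F ! (k - 1)))"
    if "k \<in> {1..length F - 1}" for k
    using matroid_minor[OF matroid] inc[OF that] sub[of k] dec that by auto
  have ext: "matroid (minor M (F' ! (k - 1)) (F' ! k))"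
    "uniactive_external (minor M (F' ! (k - 1)) (F' ! k)) (B \<inter> (F' ! (k - 1) - F' ! k))"
    if "k \<in> {1..length F' - 1}" for k
    using matroid_minor[OF matroid] dec'[OF that] sub'[of "k - 1"] dec that by auto
  show "connected_filtration M (F', Fc, F)"
    unfolding connected_filtration.simps
    using filt uniactive_internalD[OF int] uniactive_externalD[OF ext] by blast
  show "\<forall>k\<in>{1..length F - 1}. is_isthmus (minor M (F ! k) (F ! (k - 1))) \<longrightarrow>
          B \<inter> (F ! k - F ! (k - 1)) = ground (minor M (F ! k) (F ! (k - 1)))"
    using uniactive_internalD(3)[OF int] by blast
  show "\<forall>k\<in>{1..length F' - 1}. is_loop (minor M (F' ! (k - 1)) (F' ! k)) \<longrightarrow>
          B \<inter> (F' ! (k - 1) - F' ! k) = {}"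
    using uniactive_externalD(3)[OF ext] by blast
qed

end

theorem theorem4p22:
  fixes M :: "'a::linorder set_system" and B :: "'a set"
  assumes "matroid M" and "basis M B"
  shows "(\<forall>\<F>. filtration (ground M) \<F> \<and> uniactive_decomposition M B \<F> \<longleftrightarrow>
               \<F> = active_filtration M B) \<and>
         (\<forall>\<F>. connected_filtration M \<F> \<and> uniactive_decomposition M B \<F> \<longleftrightarrow>
               \<F> = active_filtration M B) \<and>
         connected_filtration M (active_filtration M B) \<and>
         (case active_filtration M B of (F', Fc, F) \<Rightarrow>
           (\<forall>k\<in>{1..length F - 1}. is_isthmus (minor M (F ! k) (F ! (k - 1))) \<longrightarrow>
              B \<inter> (F ! k - F ! (k - 1)) = ground (minor M (F ! k) (F ! (k - 1)))) \<and>
           (\<forall>k\<in>{1..length F' - 1}. is_loop (minor M (F' ! (k - 1)) (F' ! k)) \<longrightarrow>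
              B \<inter> (F' ! (k - 1) - F' ! k) = {}))"
proof -
  interpret matroid_basis M B using assms by unfold_locales
  have iff: "filtration (ground M) \<F> \<and> uniactive_decomposition M B \<F> \<longleftrightarrow> \<F> = active_filtration M B" for \<F>
    using decomposition_unique active_filtration_decomposition by (cases \<F>) blast
  \<comment> \<open>Uniactivity already makes every minor connected, and of the allowed kind, so
    under it both notions of filtration coincide.\<close>
  have conn: "connected_filtration M \<F> \<longleftrightarrow> filtration (ground M) \<F>"
    if "uniactive_decomposition M B \<F>" for \<F>
    using connected_decomposition(1) that by (cases \<F>) auto
  obtain F' Fc F where eq: "active_filtration M B = (F', Fc, F)" by (cases "active_filtration M B") auto
  have "filtration (ground M) (F', Fc, F)" "uniactive_decomposition M B (F', Fc, F)"
    using iff[of "(F', Fc, F)"] eq by simp_all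
  note conn_dec = connected_decomposition[OF this]
  show ?thesis
    using iff conn conn_dec unfolding eq prod.case by blast
qed

end
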